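(* Let $\mathcal{C}, \mathcal{C}'$ be $k$-clusterings of the same data set, with clustering-difference graph $D := CDG(\mathcal{C}, \mathcal{C}')$. Let $\mathcal{Y} = \{Y_1,\dots,Y_s\}$ ($s \ge 1$) be a set of pairwise vertex-disjoint directed cycles in $D$, and let $P = w_1 w_2 \dots w_t$ be a directed path in $D$ (from $w_1$ to $w_t$) that is edge-disjoint from the cycles in $\mathcal{Y}$. Then there exists a double-move starting from $\mathcal{C}$ (a sequence of two moves, each of which is a cyclical move or a sequential move), resulting in some $k$-clustering $\mathcal{C}''$, which accomplishes all of the following: 1. It correctly applies all transfers from $\mathcal{Y}$: for each edge $(c_a,c_b)$ with label $x$ of a cycle in $\mathcal{Y}$, item $x$ lies in the $b$-th cluster of $\mathcal{C}''$. 2. It reduces the size of the cluster corresponding to $w_1$ through sending a correct item. 3. It increases the size of the cluster corresponding to $w_t$ through receiving a correct item. 4. It decreases the shared degree of each vertex covered by $\mathcal{Y}$ by at least one; that is, the shared degree of each such vertex in $CDG(\mathcal{C}'',\mathcal{C}')$ is at least one less than its shared degree in $CDG(\mathcal{C},\mathcal{C}')$.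
   Context: A $k$-clustering of a finite data set $X=\{x_1,\dots,x_n\}$ is an ordered partition $\mathcal{C}=(C_1,\dots,C_k)$ of $X$ into $k$ labeled (possibly empty) clusters, each item lying in exactly one cluster. For two $k$-clusterings $\mathcal{C}=(C_1,\dots,C_k)$, $\mathcal{C}'=(C_1',\dots,C_k')$ of $X$, the clustering-difference graph $CDG(\mathcal{C},\mathcal{C}')$ is the directed arc-labeled multigraph with vertex set $\{c_1,\dots,c_k\}$ having an edge $(c_i,c_j)$ with label $x_\ell$ if and only if $i\neq j$, $x_\ell\in C_i$ and $x_\ell\in C_j'$. Parallel edges are allowed (all labels are distinct). The edges are called transfers; vertex $c_i$ corresponds to the $i$-th cluster. Directed cycles and directed paths have no repeated vertices; paths have at least one edge. A cyclical move transforms a $k$-clustering $\mathcal{A}$ into a $k$-clustering $\mathcal{B}$ of the same data set for which the edges of $CDG(\mathcal{A},\mathcal{B})$ form a single directed cycle; a sequential move transforms $\mathcal{A}$ into $\mathcal{B}$ for which the edges of $CDG(\mathcal{A},\mathcal{B})$ form a single directed path. A double-move is a sequence of two such moves. The cluster corresponding to $c_a$ sends a correct item when an item of $C_a$ not belonging to $C_a'$ is moved out of it (the destination is irrelevant); it receives a correct item when an item of $C_a'$ not belonging to $C_a$ is moved into it (irrespective of which cluster it is sent from). The shared degree of a vertex in a clustering-difference graph is the minimum of its indegree and outdegree. A vertex is covered by $\mathcal{Y}$ if it lies on one of the cycles in $\mathcal{Y}$. *)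

theory Defs
  imports "HOL-Library.Disjoint_Sets" "Graph_Theory.Graph_Theory"
begin

text \<open>
  A clustering is an indexed family of clusters; only the indices in \<open>{1..k}\<close> matter.
\<close>

definition clustering :: "nat \<Rightarrow> 'a set \<Rightarrow> (nat \<Rightarrow> 'a set) \<Rightarrow> bool" where
  "clustering k X C \<longleftrightarrow> disjoint_family_on C {1..k} \<and> (\<Union>i\<in>{1..k}. C i) = X"

text \<open>
  An arc is a triple (tail, label, head), so that parallel arcs differ in their labels.
\<close>

type_synonym 'a transfer = "nat \<times> 'a \<times> nat"

definition label :: "'a transfer \<Rightarrow> 'a" where
  "label e = fst (snd e)"

definition CDG :: "nat \<Rightarrow> (nat \<Rightarrow> 'a set) \<Rightarrow> (nat \<Rightarrow> 'a set) \<Rightarrow> (nat, 'a transfer) pre_digraph" where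
  "CDG k C C' =
     \<lparr> verts = {1..k},
       arcs = {(i, x, j). i \<in> {1..k} \<and> j \<in> {1..k} \<and> i \<noteq> j \<and> x \<in> C i \<and> x \<in> C' j},
       tail = (\<lambda>e. fst e),
       head = (\<lambda>e. snd (snd e)) \<rparr>"

text \<open>
  Directed cycles and paths are represented by their lists of arcs. In \<open>pre_digraph\<close>, the
  predicate \<open>cycle\<close> already excludes repeated vertices and the empty list, whereas \<open>apath\<close>
  excludes repeated vertices but admits the empty path.
\<close>

definition directed_path :: "('v, 'e) pre_digraph \<Rightarrow> 'v \<Rightarrow> 'e list \<Rightarrow> 'v \<Rightarrow> bool" where
  "directed_path G u p v \<longleftrightarrow> pre_digraph.apath G u p v \<and> p \<noteq> []"

definition vertices_on :: "('v, 'e) pre_digraph \<Rightarrow> 'e list \<Rightarrow> 'v set" where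
  "vertices_on G p = tail G ` set p \<union> head G ` set p"

definition cyclical_move :: "nat \<Rightarrow> 'a set \<Rightarrow> (nat \<Rightarrow> 'a set) \<Rightarrow> (nat \<Rightarrow> 'a set) \<Rightarrow> bool" where
  "cyclical_move k X A B \<longleftrightarrow> clustering k X A \<and> clustering k X B \<and>
     (\<exists>p. pre_digraph.cycle (CDG k A B) p \<and> arcs (CDG k A B) = set p)"

definition sequential_move :: "nat \<Rightarrow> 'a set \<Rightarrow> (nat \<Rightarrow> 'a set) \<Rightarrow> (nat \<Rightarrow> 'a set) \<Rightarrow> bool" where
  "sequential_move k X A B \<longleftrightarrow> clustering k X A \<and> clustering k X B \<and>
     (\<exists>u p v. directed_path (CDG k A B) u p v \<and> arcs (CDG k A B) = set p)"

definition double_move :: "nat \<Rightarrow> 'a set \<Rightarrow> (nat \<Rightarrow> 'a set) \<Rightarrow> (nat \<Rightarrow> 'a set) \<Rightarrow> bool" where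
  "double_move k X A C \<longleftrightarrow>
     (\<exists>B. (cyclical_move k X A B \<or> sequential_move k X A B) \<and>
          (cyclical_move k X B C \<or> sequential_move k X B C))"

definition shared_degree :: "('v, 'e) pre_digraph \<Rightarrow> 'v \<Rightarrow> nat" where
  "shared_degree G v = min (in_degree G v) (out_degree G v)"

text \<open>
  The correct items that cluster \<open>a\<close> has sent, resp. received, when \<open>C\<close> has been transformed
  into \<open>C''\<close> and the target is \<open>C'\<close>. Where a sent item ends up, or where a received item comes
  from, plays no role. The item transferred out of \<open>a\<close> by a prescribed cycle is always among
  those sent, but it is balanced by the item which the cycle transfers into \<open>a\<close>; a change of size
  that is due to a correct item therefore needs an item that is not transferred by the cycles.
\<close>

definition correct_sent ::
  "(nat \<Rightarrow> 'a set) \<Rightarrow> (nat \<Rightarrow> 'a set) \<Rightarrow> (nat \<Rightarrow> 'a set) \<Rightarrow> nat \<Rightarrow> 'a set" where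
  "correct_sent C C' C'' a = {x. x \<in> C a \<and> x \<notin> C' a \<and> x \<notin> C'' a}"

definition correct_received ::
  "(nat \<Rightarrow> 'a set) \<Rightarrow> (nat \<Rightarrow> 'a set) \<Rightarrow> (nat \<Rightarrow> 'a set) \<Rightarrow> nat \<Rightarrow> 'a set" where
  "correct_received C C' C'' a = {x. x \<in> C' a \<and> x \<notin> C a \<and> x \<in> C'' a}"

end

theory Submission
  imports Defs
begin

text \<open>
  Only the first and the last transfer of \<open>P\<close> matter, so \<open>P\<close> is replaced by a path \<open>Q\<close> with at most
  two transfers: if \<open>P\<close> has several, the first item of \<open>P\<close> is sent from \<open>w1\<close> to the tail \<open>u\<close> of the
  last one, possibly wrongly. This costs nothing, since \<open>u\<close> sends a correct item at the same time.
  It remains to split \<open>Q\<close> and all cycles into two moves.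

  The engine is an insertion step. Suppose that some item \<open>z\<close> is transferred by both moves, first from
  \<open>p\<close> to \<open>q\<close> and then from \<open>q\<close> to \<open>r\<close>. Let \<open>c\<close> be a further cycle, disjoint from the first move, and
  let \<open>(a, y, b)\<close> be an arc of \<open>c\<close> such that \<open>b\<close> is not visited by the second move. Then the first
  move may go \<open>p \<rightarrow> b\<close> (with \<open>z\<close>), follow \<open>c\<close> from \<open>b\<close> to \<open>a\<close>, and go on \<open>a \<rightarrow> q\<close> (with \<open>y\<close>),
  provided that the second move goes \<open>q \<rightarrow> b\<close> (with \<open>y\<close>) and \<open>b \<rightarrow> r\<close> (with \<open>z\<close>). Afterwards \<open>z\<close>
  is still transferred by both moves. So it suffices to treat \<open>Q\<close> together with one or two cycles,
  which depends on how the cycles meet the at most three vertices of \<open>Q\<close>.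
\<close>

section \<open>Paths and cycles as lists of arcs\<close>

fun chain :: "nat \<Rightarrow> 'a transfer list \<Rightarrow> nat \<Rightarrow> bool" where
  "chain u [] v \<longleftrightarrow> u = v"
| "chain u (e # p) v \<longleftrightarrow> fst e = u \<and> chain (snd (snd e)) p v"

definition ends :: "'a transfer set \<Rightarrow> nat set" where
  "ends S = fst ` S \<union> (snd \<circ> snd) ` S"

definition tails :: "'a transfer list \<Rightarrow> nat set" where
  "tails p = fst ` set p"

text \<open>The arcs of a directed path or of a directed cycle; in the latter case \<open>u = v\<close>.\<close>

definition simple :: "'a transfer list \<Rightarrow> bool" where
  "simple p \<longleftrightarrow> p \<noteq> [] \<and> distinct (map fst p) \<and> (\<forall>i x. (i, x, i) \<notin> set p) \<and>
     (\<exists>u v. chain u p v \<and> (u = v \<or> v \<notin> fst ` set p))"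

text \<open>The arc set \<open>c\<close> of a cycle, cut at its arc from \<open>b\<close> to \<open>a\<close>; \<open>p\<close> is the remaining path.\<close>

definition opened :: "'a transfer set \<Rightarrow> nat \<Rightarrow> 'a transfer list \<Rightarrow> nat \<Rightarrow> 'a \<Rightarrow> bool" where
  "opened c a p b z \<longleftrightarrow>
     c = insert (b, z, a) (set p) \<and> chain a p b \<and> distinct (map fst p) \<and> b \<notin> fst ` set p \<and> a \<noteq> b"

definition circuit :: "'a transfer set \<Rightarrow> bool" where
  "circuit c \<longleftrightarrow> (\<exists>a p b z. opened c a p b z)"

definition moves :: "('a \<Rightarrow> nat) \<Rightarrow> 'a transfer set \<Rightarrow> ('a \<Rightarrow> nat) \<Rightarrow> bool" where
  "moves f S g \<longleftrightarrow>
     (\<forall>(i, x, j) \<in> S. f x = i \<and> g x = j) \<and> (\<forall>x. x \<notin> label ` S \<longrightarrow> g x = f x)"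

lemma label_arc [simp]: "label (i, x, j) = x"
  by (simp add: label_def)

lemma chain_append: "chain u (p @ q) v \<longleftrightarrow> (\<exists>w. chain u p w \<and> chain w q v)"
  by (induction p arbitrary: u) auto

lemma ends_simps [simp]:
  "ends {} = {}"
  "ends (insert (i, x, j) S) = insert i (insert j (ends S))"
  "ends (S \<union> T) = ends S \<union> ends T"
  by (auto simp: ends_def)

section \<open>The vertices of a walk\<close>

lemma chain_start: "chain a p b \<Longrightarrow> a = b \<or> a \<in> fst ` set p"
  by (cases p) auto

lemma chain_end: "chain a p b \<Longrightarrow> a = b \<or> b \<in> (snd \<circ> snd) ` set p"
  by (induction p arbitrary: a) auto

text \<open>Every vertex of a walk, except possibly the last, is the tail of one of its arcs.
  Inserting \<open>b\<close> on both sides covers the empty walk, whose vertex lies on no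
  arc.\<close>

lemma chain_ends_tail: "chain a p b \<Longrightarrow> insert b (ends (set p)) = insert b (fst ` set p)"
proof (induction p arbitrary: a)
  case (Cons e p)
  obtain i x j where e: "e = (i, x, j)" by (cases e) auto
  with Cons.prems have "chain j p b" by simp
  then show ?case using Cons.IH[of j] chain_start[of j p b] e by auto
qed simp

lemma chain_ends_head: "chain a p b \<Longrightarrow> insert a (ends (set p)) = insert a ((snd \<circ> snd) ` set p)"
proof (induction p arbitrary: a)
  case (Cons e p)
  obtain i x j where e: "e = (i, x, j)" by (cases e) auto
  with Cons.prems have "chain j p b" "i = a" by simp_all
  then show ?case using Cons.IH[of j] e by auto
qed simp

lemma arc_ends: "(i, x, j) \<in> S \<Longrightarrow> i \<in> ends S" "(i, x, j) \<in> S \<Longrightarrow> j \<in> ends S"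
  by (force simp: ends_def)+

lemma opened_ends:
  assumes "opened c a p b z"
  shows "ends c = insert b (fst ` set p)" "a \<in> fst ` set p" "p \<noteq> []"
proof -
  have *: "chain a p b" "c = insert (b, z, a) (set p)" "a \<noteq> b"
    using assms by (auto simp: opened_def)
  then show a: "a \<in> fst ` set p" using chain_start by blast
  then show "p \<noteq> []" by auto
  show "ends c = insert b (fst ` set p)"
    using * a chain_ends_tail[OF *(1)] by auto
qed

lemma tails_simps [simp]:
  "tails [] = {}"
  "tails (e # p) = insert (fst e) (tails p)"
  "tails (p @ q) = tails p \<union> tails q"
  by (auto simp: tails_def)

lemma tails_subset_ends: "tails p \<subseteq> ends (set p)"
  by (auto simp: tails_def ends_def)

lemma chain_start_tails: "chain a p b \<Longrightarrow> a = b \<or> a \<in> tails p"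
  using chain_start by (simp add: tails_def)

lemma distinct_fst_Cons:
  "distinct (map fst (e # p)) \<longleftrightarrow> fst e \<notin> tails p \<and> distinct (map fst p)"
  by (simp add: tails_def)

lemma distinct_fst_append:
  "distinct (map fst (p @ q)) \<longleftrightarrow>
     distinct (map fst p) \<and> distinct (map fst q) \<and> tails p \<inter> tails q = {}"
  by (auto simp: tails_def)

lemmas path_simps = chain_append distinct_fst_Cons distinct_fst_append

lemma openedD:
  assumes "opened c a p b z"
  shows "c = insert (b, z, a) (set p)" "chain a p b" "distinct (map fst p)" "b \<notin> tails p"
    "a \<noteq> b" "p \<noteq> []" "(b, z, a) \<notin> set p"
    "a \<in> ends c" "b \<in> ends c" "tails p \<subseteq> ends c" "ends (set p) \<subseteq> ends c"
proof -
  show c: "c = insert (b, z, a) (set p)" and "chain a p b" "distinct (map fst p)" "a \<noteq> b"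
    and b: "b \<notin> tails p"
    using assms by (simp_all add: opened_def tails_def)
  show "p \<noteq> []" "a \<in> ends c" "b \<in> ends c" "tails p \<subseteq> ends c"
    using opened_ends[OF assms] by (auto simp: tails_def)
  show "(b, z, a) \<notin> set p" using b unfolding tails_def by (metis fst_conv image_eqI)
  show "ends (set p) \<subseteq> ends c" using c by auto
qed

text \<open>A cycle can be rotated: if \<open>v\<close> is the tail of an arc inside the path, then
  the part behind that arc, the old cut arc and the part before it form the new path.\<close>

lemma opened_at_tail:
  assumes "circuit c" "v \<in> ends c"
  obtains a p z where "opened c a p v z"
proof -
  from assms(1) obtain a p b z where o: "opened c a p b z" by (auto simp: circuit_def)
  show thesis
  proof (cases "v = b")
    case True
    then show ?thesis using o that by blast
  next
    case False
    then have "v \<in> fst ` set p" using opened_ends(1)[OF o] assms(2) by auto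
    then obtain x j where "(v, x, j) \<in> set p" by force
    then obtain p1 p2 where p: "p = p1 @ (v, x, j) # p2" by (meson split_list)
    with o have "chain a p1 v" "chain j p2 b" by (auto simp: opened_def chain_append)
    then have "opened c j (p2 @ (b, z, a) # p1) v x"
      using o p chain_start[of j p2 b] by (auto simp: opened_def chain_append)
    then show ?thesis using that by blast
  qed
qed

text \<open>It suffices to cut at the tail \<open>i\<close> of an arc into \<open>v\<close>: no arc
  of the remaining path starts in \<open>i\<close>, so the arc that is cut is the one into
  \<open>v\<close>.\<close>

lemma opened_at_head:
  assumes "circuit c" "v \<in> ends c"
  obtains p b z where "opened c v p b z"
proof -
  from assms(1) obtain a p b z where o: "opened c a p b z" by (auto simp: circuit_def)
  have c: "chain a p b" "c = insert (b, z, a) (set p)" "a \<noteq> b" using o by (auto simp: opened_def)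
  then have "ends c \<subseteq> (snd \<circ> snd) ` c"
    using chain_ends_head[OF c(1)] chain_end[OF c(1)] by auto
  then obtain e where "e \<in> c" "snd (snd e) = v" using assms(2) by auto
  then obtain i y where e: "(i, y, v) \<in> c" by (metis prod.collapse)
  then have "i \<in> ends c" by (force simp: ends_def)
  then obtain a' p' z' where o': "opened c a' p' i z'" using opened_at_tail[OF assms(1)] by blast
  have "(i, y, v) \<notin> set p'" using o' by (force simp: opened_def)
  then have "a' = v" using e o' by (auto simp: opened_def)
  then show thesis using that o' by blast
qed

lemma circuit_nontrivial:
  assumes "circuit c"
  shows "\<not> ends c \<subseteq> {v}"
proof -
  obtain a p b z where o: "opened c a p b z" using assms by (auto simp: circuit_def)
  then have "a \<noteq> b" by (simp add: opened_def)
  then show ?thesis using opened_ends(1,2)[OF o] by auto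
qed

text \<open>A loop at \<open>i\<close> is either followed by another arc with tail \<open>i\<close>,
  which repeats a tail, or it is the last arc, which makes \<open>v\<close> a tail.\<close>

lemma simple_pathI:
  assumes "chain u p v" "p \<noteq> []" "distinct (map fst p)" "v \<notin> tails p"
  shows "simple p"
proof -
  have "(i, x, i) \<notin> set p" for i x
  proof
    assume "(i, x, i) \<in> set p"
    then obtain A B where p: "p = A @ (i, x, i) # B" by (meson split_list)
    then have "chain i B v" using assms(1) by (auto simp: chain_append)
    then show False using chain_start[of i B v] assms(3,4) p by (auto simp: tails_def)
  qed
  then show ?thesis using assms unfolding simple_def tails_def by blast
qed

text \<open>A single loop is a closed chain as well; the bound on the length excludes it.\<close>

lemma simple_cycleI:
  assumes "chain u p u" "1 < length p" "distinct (map fst p)"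
  shows "simple p"
proof -
  have "(i, x, i) \<notin> set p" for i x
  proof
    assume "(i, x, i) \<in> set p"
    then obtain A B where p: "p = A @ (i, x, i) # B" by (meson split_list)
    then have "chain u A i" "chain i B u" using assms(1) by (auto simp: chain_append)
    then show False using chain_start[of i B u] chain_start[of u A i] assms(2,3) p
      by (cases A; cases B) auto
  qed
  then show ?thesis using assms unfolding simple_def by fastforce
qed

section \<open>Two consecutive moves\<close>

text \<open>
  Every item has a source \<open>f\<close> and a destination \<open>h\<close>; hence an arc in \<open>T\<close> is determined by its label.
\<close>

locale transfers =
  fixes f h :: "'a \<Rightarrow> nat" and T :: "'a transfer set"
  assumes tail_arc: "(i, x, j) \<in> T \<Longrightarrow> f x = i"
    and head_arc: "(i, x, j) \<in> T \<Longrightarrow> h x = j"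
    and no_loop: "(i, x, i) \<notin> T"
begin

definition goal :: "'a transfer set \<Rightarrow> 'a \<Rightarrow> nat" where
  "goal S x = (if x \<in> label ` S then h x else f x)"

text \<open>Once \<open>S\<close> stays within the \<open>k\<close> clusters and the data set, the
  bounds on vertices and labels make both moves do so.\<close>

definition staged :: "'a transfer set \<Rightarrow> 'a transfer list \<Rightarrow> 'a transfer list \<Rightarrow> bool" where
  "staged S M1 M2 \<longleftrightarrow> simple M1 \<and> simple M2 \<and>
     ends (set M1) \<subseteq> ends S \<and> ends (set M2) \<subseteq> ends S \<and>
     label ` set M1 \<subseteq> label ` S \<and> label ` set M2 \<subseteq> label ` S \<and>
     (\<exists>g. moves f (set M1) g \<and> moves g (set M2) (goal S))"

definition detour :: "'a transfer list \<Rightarrow> 'a transfer list \<Rightarrow> bool" where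
  "detour M1 M2 \<longleftrightarrow> (\<exists>i x m j. (i, x, m) \<in> set M1 \<and> (m, x, j) \<in> set M2)"

lemma label_image_iff:
  assumes "S \<subseteq> T"
  shows "x \<in> label ` S \<longleftrightarrow> (f x, x, h x) \<in> S"
proof
  assume "x \<in> label ` S"
  then obtain i j where "(i, x, j) \<in> S" by (auto simp: label_def)
  moreover from this have "f x = i" "h x = j" using assms tail_arc head_arc by blast+
  ultimately show "(f x, x, h x) \<in> S" by simp
next
  assume "(f x, x, h x) \<in> S"
  then show "x \<in> label ` S" by (metis image_eqI label_arc)
qed

lemma goal_arc:
  assumes "S \<subseteq> T" "(i, x, j) \<in> S"
  shows "f x = i" "h x = j" "goal S x = j" "x \<in> label ` S"
proof -
  show "f x = i" and h: "h x = j" using assms tail_arc head_arc by blast+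
  show "x \<in> label ` S" using assms(2) by (metis image_eqI label_arc)
  then show "goal S x = j" using h by (simp add: goal_def)
qed

lemma moves_goal: "S \<subseteq> T \<Longrightarrow> moves f S (goal S)"
  unfolding moves_def using goal_arc by (auto simp: goal_def)

lemma staged_plain:
  assumes "D1 \<union> D2 \<subseteq> T" "D1 \<inter> D2 = {}" "set M1 = D1" "set M2 = D2" "simple M1" "simple M2"
  shows "staged (D1 \<union> D2) M1 M2"
proof -
  have sub: "D1 \<subseteq> T" "D2 \<subseteq> T" using assms(1) by auto
  note iff = label_image_iff[OF sub(1)] label_image_iff[OF sub(2)]
  have "moves (goal D1) D2 (goal (D1 \<union> D2))"
    unfolding moves_def
  proof (intro conjI ballI allI impI, clarify)
    fix i x j assume x: "(i, x, j) \<in> D2"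
    note a = goal_arc[OF sub(2) x]
    then have "x \<notin> label ` D1" using x assms(2) iff(1)[of x] by auto
    then show "goal D1 x = i \<and> goal (D1 \<union> D2) x = j" using a by (simp add: goal_def image_Un)
  next
    fix x assume "x \<notin> label ` D2"
    then show "goal (D1 \<union> D2) x = goal D1 x" by (simp add: goal_def image_Un)
  qed
  then show ?thesis
    using assms moves_goal[OF sub(1)] unfolding staged_def by (auto simp: image_Un)
qed

text \<open>The common form of all base cases with a detour: one arc \<open>(i, z, j)\<close> is
  replaced by a stop of \<open>z\<close> at \<open>m\<close>, and each other arc is performed by
  exactly one of the two moves.\<close>

lemma staged_detour:
  assumes "S \<subseteq> T" "S = insert (i, z, j) (D1 \<union> D2)"
    and "D1 \<inter> D2 = {}" "(i, z, j) \<notin> D1" "(i, z, j) \<notin> D2" "m \<in> ends S"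
    and "set M1 = insert (i, z, m) D1" "set M2 = insert (m, z, j) D2" "simple M1" "simple M2"
  shows "staged S M1 M2 \<and> detour M1 M2"
proof -
  have sub: "D1 \<subseteq> T" "D2 \<subseteq> T" using assms(1,2) by auto
  note iff = label_image_iff[OF sub(1)] label_image_iff[OF sub(2)]
  have zS: "(i, z, j) \<in> S" using assms(2) by simp
  note z = goal_arc[OF assms(1) zS]
  have z': "z \<notin> label ` D1" "z \<notin> label ` D2" using assms(4,5) z iff[of z] by auto
  have lS: "label ` S = insert z (label ` D1 \<union> label ` D2)" using assms(2) by (simp add: image_Un)
  \<comment> \<open>Between the moves \<open>z\<close> waits at \<open>m\<close>, the items of
    \<open>D1\<close> have arrived, and those of \<open>D2\<close> have not left yet.\<close>
  define g where "g x = (if x = z then m else if x \<in> label ` D1 then h x else f x)" for x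
  have "moves f (set M1) g"
    unfolding moves_def
  proof (intro conjI ballI allI impI, clarify)
    fix k x l assume "(k, x, l) \<in> set M1"
    then consider "(k, x, l) = (i, z, m)" | "(k, x, l) \<in> D1" using assms(7) by auto
    then show "f x = k \<and> g x = l"
    proof cases
      case 1
      then show ?thesis using z by (simp add: g_def)
    next
      case 2
      then show ?thesis using goal_arc[OF sub(1) 2] z' by (auto simp: g_def)
    qed
  next
    fix x assume "x \<notin> label ` set M1"
    then show "g x = f x" using assms(7) by (simp add: g_def)
  qed
  moreover have "moves g (set M2) (goal S)"
    unfolding moves_def
  proof (intro conjI ballI allI impI, clarify)
    fix k x l assume "(k, x, l) \<in> set M2"
    then consider "(k, x, l) = (m, z, j)" | "(k, x, l) \<in> D2" using assms(8) by auto
    then show "g x = k \<and> goal S x = l"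
    proof cases
      case 1
      then show ?thesis using z by (simp add: g_def)
    next
      case 2
      note a = goal_arc[OF sub(2) 2]
      then have "x \<notin> label ` D1" "x \<noteq> z" using 2 assms(3) iff(1)[of x] z' by auto
      then show ?thesis using a lS by (simp add: g_def goal_def)
    qed
  next
    fix x assume "x \<notin> label ` set M2"
    then show "goal S x = g x" using z lS assms(8) by (simp add: g_def goal_def)
  qed
  moreover have "ends (set M1) \<subseteq> ends S" "ends (set M2) \<subseteq> ends S"
    using assms(2,6,7,8) by auto
  moreover have "label ` set M1 \<subseteq> label ` S" "label ` set M2 \<subseteq> label ` S"
    using assms(2,7,8) by auto
  moreover have "detour M1 M2" using assms(7,8) unfolding detour_def by blast
  ultimately show ?thesis
    using assms(9,10) unfolding staged_def by blast
qed

section \<open>Inserting further cycles into two moves\<close>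

lemma insert_circuit:
  assumes st: "staged S M1 M2" and dt: "detour M1 M2"
    and S: "S \<union> c \<subseteq> T" "S \<inter> c = {}"
    and c: "circuit c" "ends c \<inter> ends (set M1) = {}" "b \<in> ends c" "b \<notin> ends (set M2)"
  shows "\<exists>M1' M2'. staged (S \<union> c) M1' M2' \<and> detour M1' M2' \<and>
    ends (set M1') = ends (set M1) \<union> ends c \<and> ends (set M2') = insert b (ends (set M2))"
proof -
  obtain i z m j where z: "(i, z, m) \<in> set M1" "(m, z, j) \<in> set M2"
    using dt by (auto simp: detour_def)
  obtain A B where M1: "M1 = A @ (i, z, m) # B" using z(1) by (meson split_list)
  obtain A' B' where M2: "M2 = A' @ (m, z, j) # B'" using z(2) by (meson split_list)
  obtain p a y where o: "opened c b p a y" using opened_at_head[OF c(1,3)] by blast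
  have o': "c = insert (a, y, b) (set p)" "chain b p a" "distinct (map fst p)" "a \<notin> fst ` set p" "b \<noteq> a"
    using o by (auto simp: opened_def)
  note oe = opened_ends[OF o]
  \<comment> \<open>The stop of \<open>z\<close> is shifted from \<open>m\<close> to
    \<open>b\<close>, and \<open>y\<close>, which \<open>c\<close> transfers from \<open>a\<close>
    to \<open>b\<close>, takes over the stop at \<open>m\<close>.\<close>
  define M1' where "M1' = A @ (i, z, b) # p @ (a, y, m) # B"
  define M2' where "M2' = A' @ (m, y, b) # (b, z, j) # B'"
  obtain g where g: "moves f (set M1) g" "moves g (set M2) (goal S)"
    using st by (auto simp: staged_def)
  have lab: "label ` set M1 \<subseteq> label ` S" "label ` set M2 \<subseteq> label ` S"
    and en: "ends (set M1) \<subseteq> ends S" "ends (set M2) \<subseteq> ends S"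
    and si: "simple M1" "simple M2" using st by (auto simp: staged_def)
  have sub: "S \<subseteq> T" "c \<subseteq> T" using S(1) by auto
  have disj: "label ` c \<inter> label ` S = {}"
    using S(2) label_image_iff[OF sub(1)] label_image_iff[OF sub(2)] by blast
  have "z \<in> label ` set M1" using z(1) by (metis image_eqI label_arc)
  then have zS: "z \<notin> label ` c" using disj lab(1) by blast
  have yc: "(a, y, b) \<in> c" using o'(1) by simp
  have y: "y \<in> label ` c" "f y = a" "h y = b" "y \<noteq> z"
    using goal_arc[OF sub(2) yc] zS by auto
  have dM: "distinct (map fst M1)" "distinct (map fst M2)" using si by (auto simp: simple_def)
  have new: "i \<notin> ends c" "m \<notin> ends c" "m \<noteq> b" "j \<noteq> b"
    using c(2,3,4) arc_ends[OF z(1)] arc_ends[OF z(2)] by auto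
  have tails: "fst ` set M1 \<inter> ends c = {}" "b \<notin> fst ` set M2"
    using c(2,4) by (auto simp: ends_def)
  have ac: "a \<in> ends c" using oe(1) by simp
  have e1: "ends (set M1') = ends (set M1) \<union> ends c"
    unfolding M1'_def M1 o'(1) by (auto simp: Un_insert_right)
  have e2: "ends (set M2') = insert b (ends (set M2))"
    unfolding M2'_def M2 by auto
  have s1: "simple M1'"
    unfolding simple_def
  proof (intro conjI)
    show "M1' \<noteq> []" by (simp add: M1'_def)
    show "distinct (map fst M1')"
      using dM(1) o'(3,4) tails(1) new(1) ac unfolding M1'_def M1 oe(1) by auto
    have "(k, x, k) \<notin> set p" for k x using no_loop o'(1) S(1) by blast
    moreover have "i \<noteq> b" "a \<noteq> m" using new ac c(3) by auto
    ultimately show "\<forall>k x. (k, x, k) \<notin> set M1'"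
      using si(1) unfolding simple_def M1'_def M1 by auto
    obtain u v where uv: "chain u M1 v" "u = v \<or> v \<notin> fst ` set M1"
      using si(1) by (auto simp: simple_def)
    then have "chain u M1' v"
      using o'(2) unfolding M1 M1'_def by (auto simp: chain_append)
    moreover have "v \<in> ends (set M1)"
      using uv(1) chain_ends_head[OF uv(1)] chain_ends_tail[OF uv(1)] M1
      by (cases B rule: rev_cases) (auto simp: chain_append ends_def)
    then have "v \<notin> ends c" using c(2) by auto
    then have "u = v \<or> v \<notin> fst ` set M1'"
      using uv(2) unfolding M1 M1'_def oe(1) by auto
    ultimately show "\<exists>u v. chain u M1' v \<and> (u = v \<or> v \<notin> fst ` set M1')" by blast
  qed
  have s2: "simple M2'"
    unfolding simple_def
  proof (intro conjI)
    show "M2' \<noteq> []" by (simp add: M2'_def)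
    show "distinct (map fst M2')"
      using dM(2) tails(2) new(3) unfolding M2'_def M2 by auto
    show "\<forall>k x. (k, x, k) \<notin> set M2'"
      using si(2) new unfolding simple_def M2'_def M2 by auto
    obtain u v where uv: "chain u M2 v" "u = v \<or> v \<notin> fst ` set M2"
      using si(2) by (auto simp: simple_def)
    then have "chain u M2' v"
      unfolding M2 M2'_def by (auto simp: chain_append)
    moreover have "v \<in> ends (set M2)"
      using uv(1) M2
      by (cases B' rule: rev_cases) (auto simp: chain_append ends_def)
    then have "v \<noteq> b" using c(4) by auto
    then have "u = v \<or> v \<notin> fst ` set M2'"
      using uv(2) unfolding M2 M2'_def by auto
    ultimately show "\<exists>u v. chain u M2' v \<and> (u = v \<or> v \<notin> fst ` set M2')" by blast
  qed
  \<comment> \<open>\<open>z\<close> and \<open>y\<close> are at their new stops, the other items of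
    \<open>c\<close> have arrived, and the rest is where the old first move has put it.\<close>
  define g' where "g' x =
    (if x = z then b else if x = y then m else if x \<in> label ` c then h x else g x)" for x
  have gM1: "f x = k \<and> g x = l" if "(k, x, l) \<in> set M1" for k x l
    using g(1) that by (auto simp: moves_def)
  have gM2: "g x = k \<and> goal S x = l" if "(k, x, l) \<in> set M2" for k x l
    using g(2) that by (auto simp: moves_def)
  \<comment> \<open>All arcs of one move that carry \<open>z\<close> start where \<open>z\<close> is
    before that move, and tails do not repeat.\<close>
  have notz: "x \<noteq> z" if "(k, x, l) \<in> set A \<union> set B" for k x l
  proof -
    have "(k, x, l) \<in> set M1" using that unfolding M1 by auto
    then have "x = z \<Longrightarrow> k = i" using gM1 gM1[OF z(1)] by blast
    moreover have "k \<noteq> i" using that dM(1) unfolding M1 by force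
    ultimately show ?thesis by blast
  qed
  have notz': "x \<noteq> z" if "(k, x, l) \<in> set A' \<union> set B'" for k x l
  proof -
    have "(k, x, l) \<in> set M2" using that unfolding M2 by auto
    then have "x = z \<Longrightarrow> k = m" using gM2 gM2[OF z(2)] by blast
    moreover have "k \<noteq> m" using that dM(2) unfolding M2 by force
    ultimately show ?thesis by blast
  qed
  have outc: "x \<notin> label ` c" if "(k, x, l) \<in> set M1 \<union> set M2" for k x l
  proof -
    have "x \<in> label ` set M1 \<or> x \<in> label ` set M2"
      using that by (metis UnE image_eqI label_arc)
    then show ?thesis using lab disj by blast
  qed
  have m1: "moves f (set M1') g'"
    unfolding moves_def
  proof (intro conjI ballI allI impI, clarify)
    fix k x l assume "(k, x, l) \<in> set M1'"
    then consider "(k, x, l) \<in> set A \<union> set B" | "(k, x, l) = (i, z, b)"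
      | "(k, x, l) \<in> set p" | "(k, x, l) = (a, y, m)"
      unfolding M1'_def by auto
    then show "f x = k \<and> g' x = l"
    proof cases
      case 1
      then have "(k, x, l) \<in> set M1" unfolding M1 by auto
      then show ?thesis using notz[OF 1] outc[of k x l] gM1 y(1) unfolding g'_def by auto
    next
      case 2
      then show ?thesis using gM1[OF z(1)] unfolding g'_def by simp
    next
      case 3
      then have xc: "(k, x, l) \<in> c" using o'(1) by simp
      then have "f x = k" "h x = l" using S(1) tail_arc head_arc by blast+
      moreover have "x \<in> label ` c" using xc by (metis image_eqI label_arc)
      moreover have "k \<in> fst ` set p" using 3 by force
      then have "x \<noteq> y" using o'(4) y(2) \<open>f x = k\<close> by auto
      ultimately show ?thesis using zS unfolding g'_def by auto
    next
      case 4
      then show ?thesis using y unfolding g'_def by simp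
    qed
  next
    fix x assume x: "x \<notin> label ` set M1'"
    then have "x \<notin> label ` set M1" "x \<notin> label ` c"
      unfolding M1'_def M1 o'(1) by auto
    moreover have "x \<noteq> z" using x unfolding M1'_def by auto
    ultimately show "g' x = f x" using g(1) y(1) unfolding g'_def moves_def by auto
  qed
  have gl: "goal (S \<union> c) x = (if x \<in> label ` c then h x else goal S x)" for x
    by (auto simp: goal_def image_Un)
  have m2: "moves g' (set M2') (goal (S \<union> c))"
    unfolding moves_def
  proof (intro conjI ballI allI impI, clarify)
    fix k x l assume "(k, x, l) \<in> set M2'"
    then consider "(k, x, l) \<in> set A' \<union> set B'" | "(k, x, l) = (m, y, b)" | "(k, x, l) = (b, z, j)"
      unfolding M2'_def by auto
    then show "g' x = k \<and> goal (S \<union> c) x = l"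
    proof cases
      case 1
      then have "(k, x, l) \<in> set M2" unfolding M2 by auto
      then show ?thesis using notz'[OF 1] outc[of k x l] gM2 y(1) unfolding g'_def gl by auto
    next
      case 2
      then show ?thesis using y unfolding g'_def gl by simp
    next
      case 3
      then show ?thesis using gM2[OF z(2)] zS unfolding g'_def gl by simp
    qed
  next
    fix x assume x: "x \<notin> label ` set M2'"
    then have "x \<notin> label ` set M2" "x \<noteq> z" "x \<noteq> y"
      unfolding M2'_def M2 by auto
    then show "goal (S \<union> c) x = g' x" using g(2) unfolding g'_def gl moves_def by auto
  qed
  have "b \<in> ends c" "ends (S \<union> c) = ends S \<union> ends c" using c(3) by simp_all
  then have "ends (set M1') \<subseteq> ends (S \<union> c)" "ends (set M2') \<subseteq> ends (S \<union> c)"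
    using e1 e2 en by auto
  moreover have "label ` set M1' \<subseteq> label ` (S \<union> c)" "label ` set M2' \<subseteq> label ` (S \<union> c)"
    using lab unfolding M1'_def M2'_def M1 M2 o'(1) by auto
  ultimately have "staged (S \<union> c) M1' M2'"
    using s1 s2 m1 m2 unfolding staged_def by blast
  moreover have "detour M1' M2'" unfolding detour_def M1'_def M2'_def by force
  ultimately show ?thesis using e1 e2 by blast
qed

text \<open>Inserting \<open>c\<close> adds only vertices of \<open>c\<close> to the first move and
  a single vertex of \<open>c\<close> to the second. As the cycles are pairwise disjoint, both
  conditions survive for the remaining ones.\<close>

lemma insert_circuits:
  assumes "finite R" and "staged S M1 M2" "detour M1 M2"
    and "S \<union> \<Union>R \<subseteq> T" "\<And>c. c \<in> R \<Longrightarrow> S \<inter> c = {}"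
    and "\<And>c. c \<in> R \<Longrightarrow> circuit c" "\<And>c. c \<in> R \<Longrightarrow> ends c \<inter> ends (set M1) = {}"
    and "\<And>c. c \<in> R \<Longrightarrow> \<not> ends c \<subseteq> ends (set M2)"
    and "pairwise (\<lambda>c d. ends c \<inter> ends d = {}) R"
  shows "\<exists>M1' M2'. staged (S \<union> \<Union>R) M1' M2'"
  using assms
proof (induction R arbitrary: S M1 M2 rule: finite_induct)
  case empty
  then show ?case by auto
next
  case (insert c R)
  have "\<not> ends c \<subseteq> ends (set M2)" by (rule insert.prems(7)) simp
  then obtain b where b: "b \<in> ends c" "b \<notin> ends (set M2)" by blast
  have sep: "ends c \<inter> ends d = {}" if "d \<in> R" for d
    using insert.prems(8) insert.hyps(2) that by (auto simp: pairwise_insert)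
  have sub: "S \<union> c \<subseteq> T" "S \<inter> c = {}" "circuit c" "ends c \<inter> ends (set M1) = {}"
    using insert.prems(3) insert.prems(4,5,6)[of c] by auto
  obtain M1' M2' where M: "staged (S \<union> c) M1' M2'" "detour M1' M2'"
    "ends (set M1') = ends (set M1) \<union> ends c" "ends (set M2') = insert b (ends (set M2))"
    using insert_circuit[OF insert.prems(1,2) sub b] by blast
  have "\<exists>M1'' M2''. staged ((S \<union> c) \<union> \<Union>R) M1'' M2''"
  proof (rule insert.IH[OF M(1,2)])
    show "S \<union> c \<union> \<Union>R \<subseteq> T" using insert.prems(3) by (simp add: Un_assoc)
    show "pairwise (\<lambda>c d. ends c \<inter> ends d = {}) R"
      using insert.prems(8) by (simp add: pairwise_insert)
    fix d assume d: "d \<in> R"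
    show "circuit d" using insert.prems(5)[of d] d by simp
    show "(S \<union> c) \<inter> d = {}"
      using insert.prems(4)[of d] sep[OF d] d by (auto simp: ends_def)
    show "ends d \<inter> ends (set M1') = {}"
      using insert.prems(6)[of d] sep[OF d] d M(3) by auto
    show "\<not> ends d \<subseteq> ends (set M2')"
      using insert.prems(7)[of d] sep[OF d] b(1) d M(4) by auto
  qed
  then show ?case by (simp add: Un_assoc)
qed

end


section \<open>Splitting cycles and a path into two moves\<close>

text \<open>Cycles are arc sets here. The destination \<open>h\<close> only has to agree with the
  arcs at hand, so it may differ from the target of an item, as can happen for the first item of
  \<open>P\<close>.\<close>

locale covering = transfers f h "\<Union>Y \<union> set Q" for f h :: "'a \<Rightarrow> nat" and Y Q +
  fixes w1 wt :: nat
  assumes finite_Y: "finite Y"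
    and circuits: "c \<in> Y \<Longrightarrow> circuit c"
    and apart: "pairwise (\<lambda>c d. ends c \<inter> ends d = {}) Y"
    and path: "chain w1 Q wt" "Q \<noteq> []" "distinct (map fst Q)" "wt \<notin> tails Q"
    and fresh: "c \<in> Y \<Longrightarrow> c \<inter> set Q = {}"
begin

abbreviation realizable :: bool where
  "realizable \<equiv> \<exists>M1 M2. staged (\<Union>Y \<union> set Q) M1 M2"

lemma ends_apart: "c \<in> Y \<Longrightarrow> d \<in> Y \<Longrightarrow> c \<noteq> d \<Longrightarrow> ends c \<inter> ends d = {}"
  using apart by (auto simp: pairwise_def)

lemma arcs_apart: "c \<in> Y \<Longrightarrow> d \<in> Y \<Longrightarrow> c \<noteq> d \<Longrightarrow> c \<inter> d = {}"
  using ends_apart[of c d] by (auto simp: ends_def)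

lemma ends_nonempty: "c \<in> Y \<Longrightarrow> ends c \<noteq> {}"
  using circuit_nontrivial[OF circuits] by fastforce

text \<open>\<open>c1\<close> and \<open>c2\<close> may coincide, which covers the base case with
  one cycle. All other cycles are inserted afterwards.\<close>

lemma realizableI:
  assumes "c1 \<in> Y" "c2 \<in> Y" "staged (c1 \<union> c2 \<union> set Q) M1 M2 \<and> detour M1 M2"
    and "\<And>c. c \<in> Y \<Longrightarrow> c \<noteq> c1 \<Longrightarrow> c \<noteq> c2 \<Longrightarrow>
      ends c \<inter> ends (set M1) = {} \<and> \<not> ends c \<subseteq> ends (set M2)"
  shows realizable
proof -
  let ?R = "Y - {c1, c2}"
  have eq: "c1 \<union> c2 \<union> set Q \<union> \<Union>?R = \<Union>Y \<union> set Q" using assms(1,2) by auto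
  have "\<exists>M1' M2'. staged (c1 \<union> c2 \<union> set Q \<union> \<Union>?R) M1' M2'"
  proof (rule insert_circuits)
    show "finite ?R" using finite_Y by simp
    show "staged (c1 \<union> c2 \<union> set Q) M1 M2" "detour M1 M2" using assms(3) by auto
    show "c1 \<union> c2 \<union> set Q \<union> \<Union>?R \<subseteq> \<Union>Y \<union> set Q" using eq by simp
    show "pairwise (\<lambda>c d. ends c \<inter> ends d = {}) ?R" using apart pairwise_subset by blast
    fix c assume c: "c \<in> ?R"
    show "(c1 \<union> c2 \<union> set Q) \<inter> c = {}"
      using c arcs_apart[OF assms(1), of c] arcs_apart[OF assms(2), of c] fresh[of c] by auto
    show "circuit c" using c circuits by simp
    show "ends c \<inter> ends (set M1) = {}" "\<not> ends c \<subseteq> ends (set M2)" using c assms(4) by auto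
  qed
  then show ?thesis using eq by simp
qed

section \<open>Base cases with one or two cycles\<close>

lemma path_ends: "tails Q \<subseteq> ends (set Q)" "wt \<in> ends (set Q)" "w1 \<in> ends (set Q)"
  using chain_start_tails[OF path(1)] chain_end[OF path(1)] path(1,2,4) by (cases Q; auto simp: ends_def tails_def)+

text \<open>The first move runs along \<open>c1\<close> from \<open>a\<close> to \<open>b\<close>,
  sends the item \<open>z\<close> of the closing arc to \<open>w1\<close> instead of
  \<open>a\<close>, and continues along \<open>Q\<close>; the second only takes \<open>z\<close>
  from \<open>w1\<close> to \<open>a\<close>.\<close>

lemma realizable_uncovered:
  assumes "c1 \<in> Y" "\<And>c. c \<in> Y \<Longrightarrow> ends c \<inter> ends (set Q) = {}"
  shows realizable
proof -
  obtain a p b z where o: "opened c1 a p b z"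
    using circuits[OF assms(1)] by (auto simp: circuit_def)
  note o' = openedD[OF o]
  have dis: "ends c1 \<inter> ends (set Q) = {}" "c1 \<inter> set Q = {}" using assms fresh by auto
  have ne: "a \<noteq> w1" "b \<noteq> wt" "wt \<notin> tails p" "b \<notin> tails Q" "tails p \<inter> tails Q = {}"
    using dis(1) o'(8,9,10) path_ends by blast+
  show ?thesis
  proof (rule realizableI[OF assms(1,1), of "p @ (b, z, w1) # Q" "[(w1, z, a)]"])
    show "staged (c1 \<union> c1 \<union> set Q) (p @ (b, z, w1) # Q) [(w1, z, a)] \<and>
      detour (p @ (b, z, w1) # Q) [(w1, z, a)]"
    proof (rule staged_detour[where i = b and z = z and j = a and m = w1 and
          ?D1.0 = "set p \<union> set Q" and ?D2.0 = "{}"])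
      show "simple (p @ (b, z, w1) # Q)"
        by (rule simple_pathI[of a _ wt]) (use o'(2,3,4) path ne in \<open>auto simp: path_simps simp del: list.map(2) map_append\<close>)
      show "simple [(w1, z, a)]"
        by (rule simple_pathI[of w1 _ a]) (use ne in simp_all)
      show "(b, z, a) \<notin> set p \<union> set Q" using o'(1,7) dis(2) by auto
      show "c1 \<union> c1 \<union> set Q \<subseteq> \<Union> Y \<union> set Q" using assms(1) by blast
    qed (use o'(1) path_ends in auto)
    fix c assume c: "c \<in> Y" "c \<noteq> c1"
    have "ends (set (p @ (b, z, w1) # Q)) \<subseteq> ends c1 \<union> ends (set Q)"
      "ends (set [(w1, z, a)]) \<subseteq> ends c1 \<union> ends (set Q)"
      using o'(8,9,11) path_ends(3) by auto
    then show "ends c \<inter> ends (set (p @ (b, z, w1) # Q)) = {} \<and> \<not> ends c \<subseteq> ends (set [(w1, z, a)])"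
      using ends_apart[OF c(1) assms(1) c(2)] assms(2)[OF c(1)] ends_nonempty[OF c(1)] by blast
  qed
qed

text \<open>
  \<open>Q\<close> is followed up to its first vertex \<open>q\<close> on a cycle, then \<open>c1\<close> from \<open>q\<close> on, then \<open>c2\<close>;
  the second move repairs the item sent from \<open>c1\<close> to \<open>c2\<close> and follows the rest of \<open>Q\<close>.
\<close>

lemma realizable_first:
  assumes c: "c1 \<in> Y" "c2 \<in> Y" "c1 \<noteq> c2"
    and Q: "Q = Q1 @ Q2" "chain w1 Q1 q" "chain q Q2 wt" "q \<in> ends c1"
    and other: "\<And>c. c \<in> Y \<Longrightarrow> c \<noteq> c1 \<Longrightarrow> ends c \<inter> ends (set Q) = {}"
    and first: "ends c1 \<inter> tails Q1 = {}"
  shows realizable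
proof -
  obtain p1 b1 z1 where "opened c1 q p1 b1 z1" using opened_at_head[OF circuits] c(1) Q(4) by blast
  note o1 = openedD[OF this]
  obtain a2 p2 b2 z2 where "opened c2 a2 p2 b2 z2"
    using circuits[OF c(2)] by (auto simp: circuit_def)
  note o2 = openedD[OF this]
  note dis = ends_apart[OF c] arcs_apart[OF c] fresh[OF c(1)] fresh[OF c(2)] other[OF c(2) c(3)[symmetric]]
  have sQ: "tails Q1 \<subseteq> tails Q" "tails Q2 \<subseteq> tails Q" using Q(1) by auto
  have d2Q: "a2 \<notin> ends (set Q)" "b2 \<notin> ends (set Q)" "tails p2 \<inter> ends (set Q) = {}"
    using dis(5) o2(8,9,10) by blast+
  have ne: "b2 \<notin> tails Q1" "a2 \<notin> tails Q2" "b2 \<notin> tails Q2" "wt \<noteq> a2" "wt \<noteq> b2"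
    "tails Q1 \<inter> tails p2 = {}"
    using d2Q path_ends sQ by blast+
  have ne1: "b1 \<notin> tails Q1" "tails Q1 \<inter> tails p1 = {}"
    using first o1(9,10) by blast+
  have ne2: "b2 \<noteq> b1" "b2 \<notin> tails p1" "b1 \<notin> tails p2" "tails p1 \<inter> tails p2 = {}"
    using dis(1) o1(9,10) o2(9,10) by blast+
  have dQ: "distinct (map fst Q1)" "distinct (map fst Q2)" "set Q1 \<inter> set Q2 = {}" "wt \<notin> tails Q2"
    using path(3,4) Q(1) by (auto simp: tails_def)
  \<comment> \<open>Item \<open>z1\<close> stops at \<open>a2\<close>. The second move gets there by
    the closing arc of \<open>c2\<close> and takes \<open>z1\<close> to \<open>q\<close>, where the
    rest of \<open>Q\<close> begins.\<close>
  let ?M1 = "Q1 @ p1 @ (b1, z1, a2) # p2" and ?M2 = "(b2, z2, a2) # (a2, z1, q) # Q2"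
  have qQ: "q \<in> ends (set Q)"
    using chain_start_tails[OF Q(3)] path_ends sQ by blast
  show ?thesis
  proof (rule realizableI[OF c(1,2), of ?M1 ?M2])
    show "staged (c1 \<union> c2 \<union> set Q) ?M1 ?M2 \<and> detour ?M1 ?M2"
    proof (rule staged_detour[where i = b1 and z = z1 and j = q and m = a2 and
          ?D1.0 = "set Q1 \<union> set p1 \<union> set p2" and ?D2.0 = "insert (b2, z2, a2) (set Q2)"])
      show "simple ?M1"
        by (rule simple_pathI[of w1 _ b2])
          (use o1(2,3,4) o2(2,3,4) Q(2) ne ne1 ne2 dQ in \<open>auto simp: path_simps simp del: list.map(2) map_append\<close>)
      show "simple ?M2"
        by (rule simple_pathI[of b2 _ wt]) (use o2(5) Q(3) ne dQ in \<open>auto simp: path_simps simp del: list.map(2) map_append\<close>)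
      show "(b1, z1, q) \<notin> set Q1 \<union> set p1 \<union> set p2" "(b1, z1, q) \<notin> insert (b2, z2, a2) (set Q2)"
        "(set Q1 \<union> set p1 \<union> set p2) \<inter> insert (b2, z2, a2) (set Q2) = {}"
        using o1(1,7) o2(1,7) dis(2,3,4) dQ Q(1) by auto
      show "c1 \<union> c2 \<union> set Q \<subseteq> \<Union> Y \<union> set Q" using c by blast
      show "c1 \<union> c2 \<union> set Q =
        insert (b1, z1, q) (set Q1 \<union> set p1 \<union> set p2 \<union> insert (b2, z2, a2) (set Q2))"
        using o1(1) o2(1) Q(1) by auto
    qed (use o2(8) in auto)
    fix c assume c': "c \<in> Y" "c \<noteq> c1" "c \<noteq> c2"
    have "ends (set ?M1) \<subseteq> ends c1 \<union> ends c2 \<union> ends (set Q)"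
      "ends (set ?M2) \<subseteq> ends c2 \<union> ends (set Q)"
      using o1(9,11) o2(8,9,11) qQ Q(1) by auto
    then show "ends c \<inter> ends (set ?M1) = {} \<and> \<not> ends c \<subseteq> ends (set ?M2)"
      using ends_apart[OF c'(1) c(1) c'(2)] ends_apart[OF c'(1) c(2) c'(3)] other[OF c'(1,2)]
        ends_nonempty[OF c'(1)] by blast
  qed
qed

text \<open>
  The first move follows \<open>c2\<close>, then \<open>c1\<close> up to \<open>q\<close>, the last vertex of \<open>Q\<close> on a cycle, and then the
  rest of \<open>Q\<close>; the second move starts with the part of \<open>Q\<close> up to \<open>q\<close>.
\<close>

lemma realizable_last:
  assumes c: "c1 \<in> Y" "c2 \<in> Y" "c1 \<noteq> c2"
    and Q: "Q = Q1 @ Q2" "chain w1 Q1 q" "chain q Q2 wt"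
    and o: "opened c1 a p1 q z1" "a \<notin> tails Q1"
    and last: "\<And>c v. c \<in> Y \<Longrightarrow> v \<in> ends c \<Longrightarrow> v \<in> ends (set Q2) \<Longrightarrow> v = q"
    and other: "\<And>c. c \<in> Y \<Longrightarrow> c \<noteq> c1 \<Longrightarrow> \<not> ends c \<subseteq> tails Q1"
  shows realizable
proof -
  note o1 = openedD[OF o(1)]
  \<comment> \<open>The second move starts with \<open>Q1\<close> and will end in \<open>a2\<close>,
    which therefore has to avoid the tails of \<open>Q1\<close>.\<close>
  obtain a2 where a2: "a2 \<in> ends c2" "a2 \<notin> tails Q1" using other[OF c(2) c(3)[symmetric]] by auto
  obtain p2 b2 z2 where "opened c2 a2 p2 b2 z2" using opened_at_head[OF circuits] c(2) a2(1) by blast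
  note o2 = openedD[OF this]
  note dis = ends_apart[OF c] arcs_apart[OF c] fresh[OF c(1)] fresh[OF c(2)]
  have dQ: "distinct (map fst Q1)" "distinct (map fst Q2)" "set Q1 \<inter> set Q2 = {}" "wt \<notin> tails Q2"
    "wt \<notin> tails Q1" "tails Q1 \<inter> tails Q2 = {}"
    using path(3,4) Q(1) by (auto simp: tails_def)
  have q: "q \<notin> tails Q1" using chain_start_tails[OF Q(3)] dQ(5,6) by blast
  have wt: "wt = q \<or> wt \<in> ends (set Q2)" using chain_end[OF Q(3)] by (auto simp: ends_def)
  have wt': "wt \<notin> ends c2" "wt \<in> ends c1 \<Longrightarrow> wt = q"
    using wt last[OF c(2), of wt] last[OF c(1), of wt] dis(1) o1(9) by auto
  have ne: "q \<notin> ends c2" "a \<notin> ends c2" "b2 \<notin> ends c1" using dis(1) o1(8,9) o2(9) by auto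
  have wt1: "wt \<notin> tails p1" using wt'(2) o1(4,10) by auto
  have wt2: "wt \<notin> tails p2" "b2 \<noteq> wt" using wt'(1) o2(9,10) by auto
  have ne': "tails p1 \<inter> tails p2 = {}" "b2 \<notin> tails p1"
    using dis(1) o1(10) o2(9,10) by auto
  have Q2: "tails Q2 \<subseteq> ends (set Q2)" by (rule tails_subset_ends)
  have "ends c1 \<inter> tails Q2 \<subseteq> {q}" "ends c2 \<inter> tails Q2 \<subseteq> {q}"
    using last[OF c(1)] last[OF c(2)] Q2 by auto
  then have ne2: "tails p1 \<inter> tails Q2 = {}" "tails p2 \<inter> tails Q2 = {}" "b2 \<notin> tails Q2"
    using ne(1) o1(4,10) o2(9,10) by auto
  have ne3: "a2 \<noteq> q" "a2 \<noteq> a" using ne(1,2) a2(1) by auto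
  \<comment> \<open>Item \<open>z2\<close> stops at \<open>a\<close>. The second move gets there
    along \<open>Q1\<close> and the closing arc of \<open>c1\<close>, and then delivers
    \<open>z2\<close>.\<close>
  let ?M1 = "p2 @ (b2, z2, a) # p1 @ Q2" and ?M2 = "Q1 @ [(q, z1, a), (a, z2, a2)]"
  show ?thesis
  proof (rule realizableI[OF c(1,2), of ?M1 ?M2])
    show "staged (c1 \<union> c2 \<union> set Q) ?M1 ?M2 \<and> detour ?M1 ?M2"
    proof (rule staged_detour[where i = b2 and z = z2 and j = a2 and m = a and
          ?D1.0 = "set p1 \<union> set p2 \<union> set Q2" and ?D2.0 = "insert (q, z1, a) (set Q1)"])
      show "simple ?M1"
      proof (rule simple_pathI[of a2 _ wt])
        show "chain a2 ?M1 wt" using o1(2) o2(2) Q(3) by (auto simp: chain_append)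
        show "distinct (map fst ?M1)" using o1(3) o2(3,4) dQ ne' ne2
          by (auto simp: path_simps simp del: list.map(2) map_append)
        show "wt \<notin> tails ?M1" using dQ wt1 wt2 by auto
      qed simp
      show "simple ?M2"
        by (rule simple_pathI[of w1 _ a2]) (use o1(5) a2 o Q ne3 q dQ in \<open>auto simp: path_simps simp del: list.map(2) map_append\<close>)
      show "(b2, z2, a2) \<notin> set p1 \<union> set p2 \<union> set Q2" "(b2, z2, a2) \<notin> insert (q, z1, a) (set Q1)"
        "(set p1 \<union> set p2 \<union> set Q2) \<inter> insert (q, z1, a) (set Q1) = {}"
        using o1(1,7) o2(1,7) dis(2,3,4) dQ Q(1) by auto
      show "c1 \<union> c2 \<union> set Q \<subseteq> \<Union> Y \<union> set Q" using c by blast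
      show "c1 \<union> c2 \<union> set Q =
        insert (b2, z2, a2) (set p1 \<union> set p2 \<union> set Q2 \<union> insert (q, z1, a) (set Q1))"
        using o1(1) o2(1) Q(1) by auto
    qed (use o1(8) in auto)
    fix c assume c': "c \<in> Y" "c \<noteq> c1" "c \<noteq> c2"
    have M: "ends (set ?M1) \<subseteq> ends c1 \<union> ends c2 \<union> ends (set Q2)"
      using o1(8,11) o2(9,11) by (simp add: le_supI1 le_supI2)
    have "ends (set Q1) \<subseteq> insert q (tails Q1)"
      using chain_ends_tail[OF Q(2)] by (auto simp: tails_def)
    then have M': "ends (set ?M2) \<subseteq> tails Q1 \<union> ends c1 \<union> ends c2"
      using o1(8,9) a2(1) by auto
    have sep: "ends c \<inter> ends c1 = {}" "ends c \<inter> ends c2 = {}"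
      using ends_apart[OF c'(1) c(1) c'(2)] ends_apart[OF c'(1) c(2) c'(3)] by simp_all
    have "q \<notin> ends c" using sep(1) o1(9) by blast
    then have "ends c \<inter> ends (set Q2) = {}" using last[OF c'(1)] by blast
    then have "ends c \<inter> ends (set ?M1) = {}" using M sep by blast
    moreover have "\<not> ends c \<subseteq> ends (set ?M2)" using M' sep other[OF c'(1,2)] by blast
    ultimately show "ends c \<inter> ends (set ?M1) = {} \<and> \<not> ends c \<subseteq> ends (set ?M2)" ..
  qed
qed

lemma realizable_within:
  assumes "c1 \<in> Y" "c2 \<in> Y" "staged (c1 \<union> c2 \<union> set Q) M1 M2 \<and> detour M1 M2"
    and "ends (set M1) \<subseteq> ends c1 \<union> ends c2" "ends (set M2) \<subseteq> ends c1 \<union> ends c2"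
  shows realizable
proof (rule realizableI[OF assms(1-3)])
  fix c assume c: "c \<in> Y" "c \<noteq> c1" "c \<noteq> c2"
  show "ends c \<inter> ends (set M1) = {} \<and> \<not> ends c \<subseteq> ends (set M2)"
    using ends_apart[OF c(1) assms(1) c(2)] ends_apart[OF c(1) assms(2) c(3)] ends_nonempty[OF c(1)]
      assms(4,5) by blast
qed

section \<open>Exceptional configurations of a path with two transfers\<close>

context
  fixes u :: nat and x y :: 'a
  assumes Q: "Q = [(w1, x, u), (u, y, wt)]"
begin

lemma path_distinct: "w1 \<noteq> u" "w1 \<noteq> wt" "u \<noteq> wt"
  using path(3,4) Q by auto

lemma path_fresh: "c \<in> Y \<Longrightarrow> (w1, x, u) \<notin> c \<and> (u, y, wt) \<notin> c"
  using fresh[of c] Q by auto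

text \<open>
  The next three lemmas cover the configurations that \<open>realizable_last\<close> excludes: an arc from \<open>wt\<close>
  to \<open>w1\<close>, an arc from \<open>wt\<close> to \<open>u\<close>, and a cycle through no vertices but \<open>u\<close> and \<open>w1\<close>. In each
  of them one of the two moves is a cycle.
\<close>

lemma realizable_back_to_start:
  assumes c: "c1 \<in> Y" "c2 \<in> Y" "c1 \<noteq> c2" and o: "opened c1 w1 p1 wt z1" and u: "u \<in> ends c2"
  shows realizable
proof -
  note o1 = openedD[OF o]
  obtain v p2 z2 where "opened c2 v p2 u z2" using opened_at_tail[OF circuits] c(2) u by blast
  note o2 = openedD[OF this]
  obtain p b z where p: "p1 = p @ [(b, z, wt)]" "chain w1 p b"
    using o1(2,6) by (cases p1 rule: rev_cases) (auto simp: chain_append)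
  have dp: "distinct (map fst p)" "b \<notin> tails p" "b \<noteq> wt" "wt \<notin> tails p" "(b, z, wt) \<notin> set p"
    using o1(3,4) unfolding p(1) by (force simp: tails_def)+
  have bc: "b \<in> ends c1" "tails p \<subseteq> ends c1" "ends (set p) \<subseteq> ends c1"
    using o1(10,11) unfolding p(1) by auto
  have c1: "c1 = insert (wt, z1, w1) (insert (b, z, wt) (set p))" using o1(1) p(1) by auto
  have n1: "u \<notin> ends c1" "v \<notin> ends c1" using ends_apart[OF c] o2(8,9) by auto
  have n2: "tails p \<inter> tails p2 = {}" "b \<notin> tails p2" "wt \<notin> tails p2"
    using ends_apart[OF c] o2(10) bc o1(9) by auto
  have n3: "u \<noteq> b" "u \<notin> tails p" "v \<noteq> w1" "v \<noteq> wt" using n1 bc o1(8,9) by auto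
  \<comment> \<open>Item \<open>z\<close> of the last arc of \<open>p1\<close> stops at
    \<open>v\<close> on its way to \<open>wt\<close>. The first move is closed by the arc of
    \<open>z1\<close> from \<open>wt\<close> to \<open>w1\<close>.\<close>
  let ?M1 = "p @ (b, z, v) # p2 @ [(u, y, wt), (wt, z1, w1)]"
    and ?M2 = "[(w1, x, u), (u, z2, v), (v, z, wt)]"
  show ?thesis
  proof (rule realizable_within[OF c(1,2), of ?M1 ?M2])
    show "staged (c1 \<union> c2 \<union> set Q) ?M1 ?M2 \<and> detour ?M1 ?M2"
    proof (rule staged_detour[where i = b and z = z and j = wt and m = v and
          ?D1.0 = "set p \<union> set p2 \<union> {(u, y, wt), (wt, z1, w1)}" and
          ?D2.0 = "{(w1, x, u), (u, z2, v)}"])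
      show "simple ?M1"
        by (rule simple_cycleI[of w1])
          (use o2(2,3,4) p(2) dp n2 n3 path_distinct in
            \<open>auto simp: path_simps simp del: list.map(2) map_append\<close>)
      show "simple ?M2"
        by (rule simple_pathI[of w1 _ wt]) (use n3 o2(5) path_distinct in auto)
      show "c1 \<union> c2 \<union> set Q \<subseteq> \<Union> Y \<union> set Q" using c by blast
      show "c1 \<union> c2 \<union> set Q = insert (b, z, wt)
        ((set p \<union> set p2 \<union> {(u, y, wt), (wt, z1, w1)}) \<union> {(w1, x, u), (u, z2, v)})"
        using c1 o2(1) Q by auto
      show "(set p \<union> set p2 \<union> {(u, y, wt), (wt, z1, w1)}) \<inter> {(w1, x, u), (u, z2, v)} = {}"
        "(b, z, wt) \<notin> set p \<union> set p2 \<union> {(u, y, wt), (wt, z1, w1)}"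
        "(b, z, wt) \<notin> {(w1, x, u), (u, z2, v)}"
        using dp(3,5) arcs_apart[OF c] c1 o2(1,7) path_fresh[OF c(1)] path_fresh[OF c(2)] n3 path_distinct
        by auto
    qed (use o2(8) in auto)
    show "ends (set ?M1) \<subseteq> ends c1 \<union> ends c2" "ends (set ?M2) \<subseteq> ends c1 \<union> ends c2"
      using bc o1(8,9) o2(8,9,11) by auto
  qed
qed

lemma realizable_back_to_middle:
  assumes c: "c1 \<in> Y" "c2 \<in> Y" "c1 \<noteq> c2" and o: "opened c1 u p1 wt z1" and w: "w1 \<in> ends c2"
  shows realizable
proof -
  note o1 = openedD[OF o]
  obtain v p2 z2 where "opened c2 v p2 w1 z2" using opened_at_tail[OF circuits] c(2) w by blast
  note o2 = openedD[OF this]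
  have n1: "w1 \<notin> tails p1" "v \<noteq> u" "v \<noteq> wt"  using ends_apart[OF c] o1(8,9,10) o2(8,9) by auto
  have n2: "tails p1 \<inter> tails p2 = {}" "wt \<notin> tails p2"
    using ends_apart[OF c] o1(9,10) o2(10) by auto
  \<comment> \<open>Item \<open>z1\<close>, bound from \<open>wt\<close> to \<open>u\<close>, stops
    at \<open>v\<close>; the transfer of \<open>x\<close> closes the first move.\<close>
  let ?M1 = "p1 @ (wt, z1, v) # p2 @ [(w1, x, u)]" and ?M2 = "[(w1, z2, v), (v, z1, u), (u, y, wt)]"
  show ?thesis
  proof (rule realizable_within[OF c(1,2), of ?M1 ?M2])
    show "staged (c1 \<union> c2 \<union> set Q) ?M1 ?M2 \<and> detour ?M1 ?M2"
    proof (rule staged_detour[where i = wt and z = z1 and j = u and m = v and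
          ?D1.0 = "set p1 \<union> set p2 \<union> {(w1, x, u)}" and
          ?D2.0 = "{(w1, z2, v), (u, y, wt)}"])
      show "simple ?M1"
        by (rule simple_cycleI[of u])
          (use o1(2,3,4) o2(2,3,4) n1 n2 path_distinct in
            \<open>auto simp: path_simps simp del: list.map(2) map_append\<close>)
      show "simple ?M2"
        by (rule simple_pathI[of w1 _ wt]) (use n1 o2(5) path_distinct in auto)
      show "c1 \<union> c2 \<union> set Q \<subseteq> \<Union> Y \<union> set Q" using c by blast
      show "c1 \<union> c2 \<union> set Q = insert (wt, z1, u)
        ((set p1 \<union> set p2 \<union> {(w1, x, u)}) \<union> {(w1, z2, v), (u, y, wt)})"
        using o1(1) o2(1) Q by auto
      show "(set p1 \<union> set p2 \<union> {(w1, x, u)}) \<inter> {(w1, z2, v), (u, y, wt)} = {}"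
        "(wt, z1, u) \<notin> set p1 \<union> set p2 \<union> {(w1, x, u)}"
        "(wt, z1, u) \<notin> {(w1, z2, v), (u, y, wt)}"
        using arcs_apart[OF c] o1(1,7) o2(1,7) path_fresh[OF c(1)] path_fresh[OF c(2)] n1 path_distinct
        by auto
    qed (use o2(8) in auto)
    show "ends (set ?M1) \<subseteq> ends c1 \<union> ends c2" "ends (set ?M2) \<subseteq> ends c1 \<union> ends c2"
      using o1(8,9,11) o2(8,9,11) by auto
  qed
qed

lemma realizable_middle_to_start:
  assumes c: "c1 \<in> Y" "c2 \<in> Y" "c1 \<noteq> c2" and o: "opened c2 w1 p2 u z2" and wt: "wt \<in> ends c1"
  shows realizable
proof -
  note o2 = openedD[OF o]
  obtain p1 b z1 where "opened c1 wt p1 b z1" using opened_at_head[OF circuits] c(1) wt by blast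
  note o1 = openedD[OF this]
  have n1: "b \<noteq> w1" "b \<noteq> u" "u \<notin> tails p1" "b \<notin> tails p2"
    using ends_apart[OF c] o1(9,10) o2(8,9,10) by auto
  have n2: "tails p1 \<inter> tails p2 = {}"
    using ends_apart[OF c] o1(10) o2(10) by auto
  \<comment> \<open>Item \<open>z2\<close>, bound from \<open>u\<close> to \<open>w1\<close>, stops
    at \<open>b\<close>; now the second move is the closed one, by the transfer of
    \<open>y\<close>.\<close>
  let ?M1 = "[(w1, x, u), (u, z2, b), (b, z1, wt)]" and ?M2 = "p1 @ (b, z2, w1) # p2 @ [(u, y, wt)]"
  show ?thesis
  proof (rule realizable_within[OF c(1,2), of ?M1 ?M2])
    show "staged (c1 \<union> c2 \<union> set Q) ?M1 ?M2 \<and> detour ?M1 ?M2"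
    proof (rule staged_detour[where i = u and z = z2 and j = w1 and m = b and
          ?D1.0 = "{(w1, x, u), (b, z1, wt)}" and
          ?D2.0 = "set p1 \<union> set p2 \<union> {(u, y, wt)}"])
      show "simple ?M1"
        by (rule simple_pathI[of w1 _ wt]) (use n1 o1(5) path_distinct in auto)
      show "simple ?M2"
        by (rule simple_cycleI[of wt])
          (use o1(2,3,4) o2(2,3,4) n1 n2 path_distinct in
            \<open>auto simp: path_simps simp del: list.map(2) map_append\<close>)
      show "c1 \<union> c2 \<union> set Q \<subseteq> \<Union> Y \<union> set Q" using c by blast
      show "c1 \<union> c2 \<union> set Q = insert (u, z2, w1)
        ({(w1, x, u), (b, z1, wt)} \<union> (set p1 \<union> set p2 \<union> {(u, y, wt)}))"
        using o1(1) o2(1) Q by auto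
      show "{(w1, x, u), (b, z1, wt)} \<inter> (set p1 \<union> set p2 \<union> {(u, y, wt)}) = {}"
        "(u, z2, w1) \<notin> {(w1, x, u), (b, z1, wt)}"
        "(u, z2, w1) \<notin> set p1 \<union> set p2 \<union> {(u, y, wt)}"
        using arcs_apart[OF c] o1(1,7) o2(1,7) path_fresh[OF c(1)] path_fresh[OF c(2)] n1 path_distinct
        by auto
    qed (use o1(9) in auto)
    show "ends (set ?M1) \<subseteq> ends c1 \<union> ends c2" "ends (set ?M2) \<subseteq> ends c1 \<union> ends c2"
      using o1(8,9,11) o2(8,9,11) by auto
  qed
qed

end

section \<open>Distinction by the cycles that meet \<open>Q\<close>\<close>

lemma realizable_single:
  assumes "Y = {c}"
  shows realizable
proof -
  obtain a p b z where "opened c a p b z" using circuits assms by (auto simp: circuit_def)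
  note o = openedD[OF this]
  \<comment> \<open>A single cycle and \<open>Q\<close> are two moves already, and no item has to
    stop on its way.\<close>
  have "staged (c \<union> set Q) (p @ [(b, z, a)]) Q"
  proof (rule staged_plain)
    show "c \<union> set Q \<subseteq> \<Union> Y \<union> set Q" "c \<inter> set Q = {}" using assms fresh by auto
    show "simple (p @ [(b, z, a)])"
      by (rule simple_cycleI[of a])
        (use o(2,3,4,6) in \<open>auto simp: path_simps simp del: list.map(2) map_append\<close>)
    show "simple Q" using path simple_pathI by blast
  qed (use o(1) in simp_all)
  then show ?thesis using assms by auto
qed

lemma chain_first:
  assumes "chain a p b" "S \<inter> insert b (tails p) \<noteq> {}"
  shows "\<exists>p1 p2 q. p = p1 @ p2 \<and> chain a p1 q \<and> chain q p2 b \<and> q \<in> S \<and> S \<inter> tails p1 = {}"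
  using assms
proof (induction p arbitrary: a)
  case Nil
  then show ?case by (intro exI[of _ "[]"]) auto
next
  case (Cons e p)
  show ?case
  proof (cases "a \<in> S")
    case True
    then show ?thesis
      using Cons.prems(1) by (intro exI[of _ "[]"] exI[of _ "e # p"] exI[of _ a]) simp
  next
    case False
    moreover have e: "fst e = a" "chain (snd (snd e)) p b" using Cons.prems(1) by simp_all
    ultimately have "S \<inter> insert b (tails p) \<noteq> {}" using Cons.prems(2) by auto
    then obtain p1 p2 q where p: "p = p1 @ p2" "chain (snd (snd e)) p1 q" "chain q p2 b"
      "q \<in> S" "S \<inter> tails p1 = {}"
      using Cons.IH[OF e(2)] by blast
    have "e # p = (e # p1) @ p2" "chain a (e # p1) q" "S \<inter> tails (e # p1) = {}"
      using p e False by simp_all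
    then show ?thesis using p(3,4) by blast
  qed
qed

lemma realizable_one_meets:
  assumes "c1 \<in> Y" "Y \<noteq> {c1}" "ends c1 \<inter> ends (set Q) \<noteq> {}"
    and "\<And>c. c \<in> Y \<Longrightarrow> c \<noteq> c1 \<Longrightarrow> ends c \<inter> ends (set Q) = {}"
  shows realizable
proof -
  obtain c2 where c2: "c2 \<in> Y" "c1 \<noteq> c2" using assms(1,2) by blast
  have "ends c1 \<inter> insert wt (tails Q) \<noteq> {}"
    using assms(3) chain_ends_tail[OF path(1)] by (auto simp: tails_def)
  then obtain Q1 Q2 q where q: "Q = Q1 @ Q2" "chain w1 Q1 q" "chain q Q2 wt" "q \<in> ends c1"
    "ends c1 \<inter> tails Q1 = {}"
    using chain_first[OF path(1), of "ends c1"] by blast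
  show ?thesis by (rule realizable_first[OF assms(1) c2 q(1-4) assms(4) q(5)])
qed

text \<open>This is \<open>realizable_last\<close> with all of \<open>Q\<close> in front of
  \<open>q = wt\<close>: the only tail \<open>w1\<close> lies on \<open>c2\<close>, so it differs
  from the vertex \<open>a\<close> of \<open>c1\<close>, and one vertex does not contain a
  cycle.\<close>

lemma realizable_short:
  assumes "Q = [(w1, x, wt)]" "c1 \<in> Y" "c2 \<in> Y" "c1 \<noteq> c2" "wt \<in> ends c1" "w1 \<in> ends c2"
  shows realizable
proof -
  obtain a p z where o: "opened c1 a p wt z" using opened_at_tail[OF circuits] assms(2,5) by blast
  have "a \<noteq> w1" using openedD(8)[OF o] ends_apart[OF assms(2-4)] assms(6) by auto
  then show ?thesis
    using circuit_nontrivial[OF circuits] path(1) assms(1)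
    by (intro realizable_last[OF assms(2-4) _ _ _ o, of Q "[]"]) simp_all
qed

text \<open>If no cycle contains \<open>wt\<close>, then \<open>u\<close> and \<open>w1\<close> lie
  on different cycles and \<open>realizable_last\<close> applies with \<open>q = u\<close>.
  Otherwise it applies with \<open>q = wt\<close>, unless the cycle arc out of \<open>wt\<close>
  leads to \<open>w1\<close> or \<open>u\<close>, or another cycle has all its vertices in
  \<open>{w1, u}\<close>; these are the exceptional configurations.\<close>

lemma realizable_long:
  assumes Q: "Q = [(w1, x, u), (u, y, wt)]"
    and d: "d1 \<in> Y" "d2 \<in> Y" "d1 \<noteq> d2" "ends d1 \<inter> {w1, u, wt} \<noteq> {}" "ends d2 \<inter> {w1, u, wt} \<noteq> {}"
  shows realizable
proof (cases "\<exists>c\<in>Y. wt \<in> ends c")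
  case False
  then have "u \<in> ends d1 \<and> w1 \<in> ends d2 \<or> u \<in> ends d2 \<and> w1 \<in> ends d1"
    using d ends_apart[OF d(1-3)] by auto
  then obtain c1 c2 where c: "c1 \<in> Y" "c2 \<in> Y" "c1 \<noteq> c2" "u \<in> ends c1" "w1 \<in> ends c2"
    using d(1-3) by metis
  obtain a p z where o: "opened c1 a p u z" using opened_at_tail[OF circuits] c(1,4) by blast
  have "a \<noteq> w1" using openedD(8)[OF o] ends_apart[OF c(1-3)] c(5) by auto
  then show ?thesis
    using Q False circuit_nontrivial[OF circuits]
    by (intro realizable_last[OF c(1-3) _ _ _ o, of "[(w1, x, u)]" "[(u, y, wt)]"]) auto
next
  case True
  then obtain c1 where c1: "c1 \<in> Y" "wt \<in> ends c1" by blast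
  obtain c2 where c2: "c2 \<in> Y" "c1 \<noteq> c2" "ends c2 \<inter> {w1, u, wt} \<noteq> {}" using d by metis
  have wc2: "wt \<notin> ends c2" using ends_apart[OF c1(1) c2(1,2)] c1(2) by auto
  obtain a p z where o: "opened c1 a p wt z" using opened_at_tail[OF circuits] c1 by blast
  have a: "a \<notin> ends c2" using openedD(8)[OF o] ends_apart[OF c1(1) c2(1,2)] by auto
  show ?thesis
  proof (cases "a \<in> {w1, u}")
    case True
    then consider "a = w1" "u \<in> ends c2" | "a = u" "w1 \<in> ends c2" using a c2(3) wc2 by auto
    then show ?thesis
      using realizable_back_to_start[OF Q c1(1) c2(1,2)]
        realizable_back_to_middle[OF Q c1(1) c2(1,2)] o by cases auto
  next
    case a: False
    show ?thesis
    proof (cases "\<exists>c\<in>Y. c \<noteq> c1 \<and> ends c \<subseteq> {w1, u}")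
      case True
      then obtain c where c: "c \<in> Y" "c1 \<noteq> c" "ends c \<subseteq> {w1, u}" by blast
      then have "u \<in> ends c" using circuit_nontrivial[OF circuits[OF c(1)], of w1] by auto
      then obtain a' p' z' where o': "opened c a' p' u z'" using opened_at_tail[OF circuits] c(1) by blast
      then have "a' = w1" using openedD(5,8)[OF o'] c(3) by auto
      then show ?thesis using realizable_middle_to_start[OF Q c1(1) c(1,2) _ c1(2)] o' by blast
    next
      case False
      then show ?thesis
        using a path(1) Q by (intro realizable_last[OF c1(1) c2(1,2) _ _ _ o, of Q "[]"]) auto
    qed
  qed
qed

lemma realizable_all:
  assumes "Y \<noteq> {}" "(\<exists>x. Q = [(w1, x, wt)]) \<or> (\<exists>u x y. Q = [(w1, x, u), (u, y, wt)])"
  shows realizable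
proof (cases "\<exists>d1\<in>Y. \<exists>d2\<in>Y. d1 \<noteq> d2 \<and> ends d1 \<inter> ends (set Q) \<noteq> {} \<and> ends d2 \<inter> ends (set Q) \<noteq> {}")
  case True
  then obtain d1 d2 where d: "d1 \<in> Y" "d2 \<in> Y" "d1 \<noteq> d2"
    "ends d1 \<inter> ends (set Q) \<noteq> {}" "ends d2 \<inter> ends (set Q) \<noteq> {}" by blast
  from assms(2) show ?thesis
  proof (elim disjE exE)
    fix x assume Q: "Q = [(w1, x, wt)]"
    then have "wt \<in> ends d1 \<and> w1 \<in> ends d2 \<or> wt \<in> ends d2 \<and> w1 \<in> ends d1"
      using d(4,5) ends_apart[OF d(1-3)] by auto
    then show ?thesis using realizable_short[OF Q] d(1-3) by metis
  next
    fix u x y assume Q: "Q = [(w1, x, u), (u, y, wt)]"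
    then have "ends (set Q) = {w1, u, wt}" by auto
    then show ?thesis using realizable_long[OF Q d(1-3)] d(4,5) by simp
  qed
next
  case False
  show ?thesis
  proof (cases "\<forall>c\<in>Y. ends c \<inter> ends (set Q) = {}")
    case True
    then show ?thesis using assms(1) realizable_uncovered by blast
  next
    case meets: False
    then obtain c1 where c1: "c1 \<in> Y" "ends c1 \<inter> ends (set Q) \<noteq> {}" by blast
    then show ?thesis
      using False realizable_one_meets[OF c1(1) _ c1(2)] realizable_single[of c1] by blast
  qed
qed

end

section \<open>Clusterings as location functions\<close>

definition located :: "nat \<Rightarrow> 'a set \<Rightarrow> ('a \<Rightarrow> nat) \<Rightarrow> (nat \<Rightarrow> 'a set) \<Rightarrow> bool" where
  "located k X f A \<longleftrightarrow> f ` X \<subseteq> {1..k} \<and> (\<forall>i\<in>{1..k}. A i = {x \<in> X. f x = i})"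

lemma clustering_located:
  assumes "clustering k X A"
  obtains f where "located k X f A"
proof -
  have U: "(\<Union>i\<in>{1..k}. A i) = X" and D: "\<And>i j. i \<in> {1..k} \<Longrightarrow> j \<in> {1..k} \<Longrightarrow> i \<noteq> j \<Longrightarrow> A i \<inter> A j = {}"
    using assms by (auto simp: clustering_def disjoint_family_on_def)
  have "\<forall>x\<in>X. \<exists>i. i \<in> {1..k} \<and> x \<in> A i" using U by blast
  then obtain f where f: "\<forall>x\<in>X. f x \<in> {1..k} \<and> x \<in> A (f x)" by metis
  have "A i = {x \<in> X. f x = i}" if i: "i \<in> {1..k}" for i
  proof
    show "A i \<subseteq> {x \<in> X. f x = i}"
    proof
      fix x assume x: "x \<in> A i"
      then have "x \<in> X" using U i by blast
      then show "x \<in> {x \<in> X. f x = i}" using f x D[OF i, of "f x"] by blast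
    qed
    show "{x \<in> X. f x = i} \<subseteq> A i" using f by blast
  qed
  then have "located k X f A" using f by (auto simp: located_def)
  then show thesis by (rule that)
qed

lemma located_clustering: "located k X f A \<Longrightarrow> clustering k X A"
  by (force simp: located_def clustering_def disjoint_family_on_def)

section \<open>The clustering-difference graph of two location functions\<close>

lemma CDG_sel [simp]:
  "verts (CDG k A B) = {1..k}" "tail (CDG k A B) e = fst e" "head (CDG k A B) e = snd (snd e)"
  by (simp_all add: CDG_def)

lemma arcs_CDG:
  assumes "located k X f A" "located k X g B"
  shows "(i, x, j) \<in> arcs (CDG k A B) \<longleftrightarrow> x \<in> X \<and> f x = i \<and> g x = j \<and> i \<noteq> j"
  using assms by (auto simp: CDG_def located_def)

lemma cas_CDG: "pre_digraph.cas (CDG k A B) u p v \<longleftrightarrow> chain u p v"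
  by (induction p arbitrary: u) (auto simp: pre_digraph.cas.simps)

lemma awalk_verts_CDG: "chain u p v \<Longrightarrow> pre_digraph.awalk_verts (CDG k A B) u p = map fst p @ [v]"
  by (induction p arbitrary: u) (auto simp: pre_digraph.awalk_verts.simps)

lemma awalk_CDG:
  "pre_digraph.awalk (CDG k A B) u p v \<longleftrightarrow> u \<in> {1..k} \<and> set p \<subseteq> arcs (CDG k A B) \<and> chain u p v"
  by (simp add: pre_digraph.awalk_def cas_CDG)

lemma vertices_on_CDG: "vertices_on (CDG k A B) p = ends (set p)"
  by (simp add: vertices_on_def ends_def)

lemma directed_pathD:
  assumes "directed_path (CDG k A B) u p v"
  shows "chain u p v" "p \<noteq> []" "distinct (map fst p)" "v \<notin> tails p" "set p \<subseteq> arcs (CDG k A B)"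
  using assms awalk_verts_CDG[of u p v k A B]
  by (auto simp: directed_path_def pre_digraph.apath_def awalk_CDG tails_def)

text \<open>The closed walk is cut at its last arc. As the graph has no loops, this arc is not the
  whole cycle.\<close>

lemma cycle_circuit:
  assumes "pre_digraph.cycle (CDG k A B) c"
  shows "circuit (set c)" "set c \<subseteq> arcs (CDG k A B)"
proof -
  obtain u where u: "chain u c u" "set c \<subseteq> arcs (CDG k A B)" "c \<noteq> []"
    "distinct (tl (pre_digraph.awalk_verts (CDG k A B) u c))"
    using assms by (auto simp: pre_digraph.cycle_def awalk_CDG)
  then have d: "distinct (tl (map fst c @ [u]))" using awalk_verts_CDG by metis
  show "set c \<subseteq> arcs (CDG k A B)" by fact
  obtain p b z where c: "c = p @ [(b, z, u)]" "chain u p b"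
    using u(1,3) by (cases c rule: rev_cases) (auto simp: chain_append)
  have "b \<noteq> u" using u(2) c(1) by (auto simp: CDG_def)
  then obtain e p' where p: "p = e # p'" "fst e = u" using c(2) by (cases p) auto
  have "opened (set c) u p b z"
    using c d p \<open>b \<noteq> u\<close> by (auto simp: opened_def)
  then show "circuit (set c)" by (auto simp: circuit_def)
qed

text \<open>The difference graph has one arc for each item whose location changes, so its arcs are
  those of \<open>p\<close>. A loop in \<open>p\<close> would yield no arc, which is why
  \<open>simple\<close> excludes loops.\<close>

lemma simple_move:
  assumes A: "located k X f A" and B: "located k X g B"
    and p: "moves f (set p) g" "simple p" "label ` set p \<subseteq> X"
  shows "cyclical_move k X A B \<or> sequential_move k X A B"
proof -
  have "(i, x, j) \<in> arcs (CDG k A B) \<longleftrightarrow> (i, x, j) \<in> set p" for i x j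
  proof
    assume "(i, x, j) \<in> arcs (CDG k A B)"
    then have *: "f x = i" "g x = j" "i \<noteq> j" using arcs_CDG[OF A B] by auto
    then have "x \<in> label ` set p" using p(1) by (auto simp: moves_def)
    then obtain i' j' where "(i', x, j') \<in> set p" by (auto simp: label_def)
    then show "(i, x, j) \<in> set p" using p(1) * by (auto simp: moves_def)
  next
    assume x: "(i, x, j) \<in> set p"
    then have "x \<in> X" using p(3) by (force simp: label_def)
    moreover have "f x = i" "g x = j" using p(1) x by (auto simp: moves_def)
    moreover have "i \<noteq> j" using p(2) x by (auto simp: simple_def)
    ultimately show "(i, x, j) \<in> arcs (CDG k A B)" using arcs_CDG[OF A B] by auto
  qed
  then have arcs: "arcs (CDG k A B) = set p" by auto
  obtain u v where uv: "chain u p v" "u = v \<or> v \<notin> fst ` set p"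
    and p': "p \<noteq> []" "distinct (map fst p)" using p(2) by (auto simp: simple_def)
  obtain e q where e: "p = e # q" "fst e = u" using uv(1) p'(1) by (cases p) auto
  then have "e \<in> arcs (CDG k A B)" using arcs by simp
  then have "u \<in> {1..k}" using e(2) by (auto simp: CDG_def)
  then have w: "pre_digraph.awalk (CDG k A B) u p v" using arcs uv(1) by (simp add: awalk_CDG)
  have vs: "pre_digraph.awalk_verts (CDG k A B) u p = map fst p @ [v]" by (rule awalk_verts_CDG[OF uv(1)])
  have cl: "clustering k X A" "clustering k X B" using A B located_clustering by blast+
  show ?thesis
  proof (cases "u = v")
    case True
    have "distinct (tl (map fst p @ [v]))" using p'(2) e True by auto
    then have "pre_digraph.cycle (CDG k A B) p"
      unfolding pre_digraph.cycle_def using w vs p'(1) True by metis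
    then show ?thesis using arcs cl by (auto simp: cyclical_move_def)
  next
    case False
    then have "distinct (map fst p @ [v])" using uv(2) p'(2) by simp
    then have "directed_path (CDG k A B) u p v"
      using w vs p'(1) by (simp add: directed_path_def pre_digraph.apath_def)
    then show ?thesis using arcs cl by (auto simp: sequential_move_def)
  qed
qed

section \<open>Degrees and cluster sizes\<close>

lemma in_degree_CDG:
  assumes "located k X f A" "located k X g B"
  shows "in_degree (CDG k A B) v = card {x \<in> X. g x = v \<and> f x \<noteq> v}"
proof -
  have "in_arcs (CDG k A B) v = (\<lambda>x. (f x, x, v)) ` {x \<in> X. g x = v \<and> f x \<noteq> v}"
    using arcs_CDG[OF assms] by (auto simp: in_arcs_def)
  then show ?thesis by (simp add: in_degree_def card_image inj_on_def)
qed

lemma out_degree_CDG: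
  assumes "located k X f A" "located k X g B"
  shows "out_degree (CDG k A B) v = card {x \<in> X. f x = v \<and> g x \<noteq> v}"
proof -
  have "out_arcs (CDG k A B) v = (\<lambda>x. (v, x, g x)) ` {x \<in> X. f x = v \<and> g x \<noteq> v}"
    using arcs_CDG[OF assms] by (auto simp: out_arcs_def)
  then show ?thesis by (simp add: out_degree_def card_image inj_on_def)
qed

text \<open>Both sides count the items that \<open>f\<close> or \<open>h\<close> places at
  \<open>v\<close>.\<close>

lemma card_after_moves:
  assumes "finite X"
  shows "card {x \<in> X. h x = v} + card {x \<in> X. f x = v \<and> h x \<noteq> v} =
    card {x \<in> X. f x = v} + card {x \<in> X. h x = v \<and> f x \<noteq> (v :: nat)}"
proof -
  let ?I = "{x \<in> X. f x = v \<and> h x = v}"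
  have "{x \<in> X. h x = v} = ?I \<union> {x \<in> X. h x = v \<and> f x \<noteq> v}"
    "{x \<in> X. f x = v} = ?I \<union> {x \<in> X. f x = v \<and> h x \<noteq> v}" by auto
  moreover have "card (?I \<union> {x \<in> X. h x = v \<and> f x \<noteq> v}) = card ?I + card {x \<in> X. h x = v \<and> f x \<noteq> v}"
    "card (?I \<union> {x \<in> X. f x = v \<and> h x \<noteq> v}) = card ?I + card {x \<in> X. f x = v \<and> h x \<noteq> v}"
    using assms by (intro card_Un_disjoint; auto)+
  ultimately show ?thesis by simp
qed

lemma circuit_arcs_at:
  assumes "circuit c" "v \<in> ends c"
  shows "\<exists>z. {x. \<exists>j. (v, x, j) \<in> c} = {z}" "\<exists>z. {x. \<exists>i. (i, x, v) \<in> c} = {z}"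
proof -
  obtain a p z where "opened c a p v z" using opened_at_tail[OF assms] by blast
  note o = openedD[OF this]
  have "(v, x, j) \<notin> set p" for x j using o(4) by (force simp: tails_def)
  then have "{x. \<exists>j. (v, x, j) \<in> c} = {z}" using o(1) by auto
  then show "\<exists>z. {x. \<exists>j. (v, x, j) \<in> c} = {z}" ..
  obtain p b z where "opened c v p b z" using opened_at_head[OF assms] by blast
  note o = openedD[OF this]
  have "(i, x, v) \<notin> set p" for i x
  proof
    assume "(i, x, v) \<in> set p"
    then obtain A B where p: "p = A @ (i, x, v) # B" by (meson split_list)
    then have "chain v A i" "chain v B b" using o(2) by (auto simp: chain_append)
    then show False
      using chain_start_tails[of v B b] chain_start_tails[of v A i] o(3,4,5) p
      by (auto simp: tails_def)
  qed
  then have "{x. \<exists>i. (i, x, v) \<in> c} = {z}" using o(1) by auto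
  then show "\<exists>z. {x. \<exists>i. (i, x, v) \<in> c} = {z}" ..
qed

lemma moves_located:
  assumes "located k X f A" "moves f (set p) g" "ends (set p) \<subseteq> {1..k}"
  shows "located k X g (\<lambda>i. {x \<in> X. g x = i})"
proof -
  have "g x \<in> {1..k}" if x: "x \<in> X" for x
  proof (cases "x \<in> label ` set p")
    case True
    then obtain i j where "(i, x, j) \<in> set p" by (auto simp: label_def)
    then show ?thesis using assms(2,3) arc_ends(2)[of i x j "set p"] by (auto simp: moves_def)
  next
    case False
    then show ?thesis using assms(1,2) x by (auto simp: moves_def located_def)
  qed
  then show ?thesis by (auto simp: located_def)
qed

context covering
begin

lemma arcs_at_covered:
  assumes "c \<in> Y" "v \<in> ends c"
  shows "{x. \<exists>j. (v, x, j) \<in> \<Union>Y} = {x. \<exists>j. (v, x, j) \<in> c}"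
    "{x. \<exists>i. (i, x, v) \<in> \<Union>Y} = {x. \<exists>i. (i, x, v) \<in> c}"
proof -
  have "d = c" if "d \<in> Y" "v \<in> ends d" for d
    using ends_apart[OF assms(1) that(1)] assms(2) that(2) by blast
  then have "(v, x, j) \<in> \<Union>Y \<longleftrightarrow> (v, x, j) \<in> c" "(j, x, v) \<in> \<Union>Y \<longleftrightarrow> (j, x, v) \<in> c" for x j
    using assms(1) arc_ends(1)[of v x j] arc_ends(2)[of j x v] by blast+
  then show "{x. \<exists>j. (v, x, j) \<in> \<Union>Y} = {x. \<exists>j. (v, x, j) \<in> c}"
    "{x. \<exists>i. (i, x, v) \<in> \<Union>Y} = {x. \<exists>i. (i, x, v) \<in> c}" by auto
qed

text \<open>A vertex lies on at most one of the cycles and so sends and receives one item each, or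
  none. Hence only \<open>Q\<close> affects the sizes of clusters.\<close>

lemma arcs_at_balanced:
  "finite {x. \<exists>j. (v, x, j) \<in> \<Union>Y} \<and> finite {x. \<exists>i. (i, x, v) \<in> \<Union>Y} \<and>
    card {x. \<exists>j. (v, x, j) \<in> \<Union>Y} = card {x. \<exists>i. (i, x, v) \<in> \<Union>Y}"
proof (cases "\<exists>c\<in>Y. v \<in> ends c")
  case True
  then obtain c where c: "c \<in> Y" "v \<in> ends c" by blast
  obtain z z' where "{x. \<exists>j. (v, x, j) \<in> c} = {z}" "{x. \<exists>i. (i, x, v) \<in> c} = {z'}"
    using circuit_arcs_at[OF circuits[OF c(1)] c(2)] by blast
  then show ?thesis unfolding arcs_at_covered[OF c] by simp
next
  case False
  then have "(v, x, j) \<notin> \<Union>Y" "(j, x, v) \<notin> \<Union>Y" for x j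
    using arc_ends(1)[of v x j] arc_ends(2)[of j x v] by blast+
  then have "{x. \<exists>j. (v, x, j) \<in> \<Union>Y} = {}" "{x. \<exists>i. (i, x, v) \<in> \<Union>Y} = {}" by auto
  then show ?thesis by simp
qed

end

section \<open>The double-move\<close>

theorem theorem1:
  fixes k :: nat and X :: "'a set" and C C' :: "nat \<Rightarrow> 'a set"
    and Y :: "'a transfer list set" and P :: "'a transfer list" and w1 wt :: nat
  defines "D \<equiv> CDG k C C'"
  assumes "finite X"
    and "clustering k X C" and "clustering k X C'"
    and "finite Y" and "Y \<noteq> {}"
    and "\<forall>c\<in>Y. pre_digraph.cycle D c"
    and "pairwise (\<lambda>c d. vertices_on D c \<inter> vertices_on D d = {}) Y"
    and "directed_path D w1 P wt"
    and "\<forall>c\<in>Y. set P \<inter> set c = {}"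
  shows "\<exists>C''. double_move k X C C'' \<and>
     (\<forall>c\<in>Y. \<forall>e\<in>set c. label e \<in> C'' (head D e)) \<and>
     (card (C'' w1) < card (C w1) \<and>
       (\<exists>x \<in> correct_sent C C' C'' w1. \<forall>c\<in>Y. x \<notin> label ` set c)) \<and>
     (card (C'' wt) > card (C wt) \<and>
       (\<exists>x \<in> correct_received C C' C'' wt. \<forall>c\<in>Y. x \<notin> label ` set c)) \<and>
     (\<forall>c\<in>Y. \<forall>v\<in>vertices_on D c.
        shared_degree (CDG k C'' C') v + 1 \<le> shared_degree D v)"
proof -
  obtain f where f: "located k X f C" using clustering_located[OF assms(3)] .
  obtain f' where f': "located k X f' C'" using clustering_located[OF assms(4)] .
  have arcD: "(i, x, j) \<in> arcs D \<longleftrightarrow> x \<in> X \<and> f x = i \<and> f' x = j \<and> i \<noteq> j" for i x j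
    unfolding D_def by (rule arcs_CDG[OF f f'])
  have V: "ends (arcs D) \<subseteq> {1..k}" by (auto simp: D_def CDG_def ends_def)
  have Yc: "circuit (set c)" "set c \<subseteq> arcs D" if "c \<in> Y" for c
    using cycle_circuit[of k C C' c] assms(7) that unfolding D_def by auto
  note P = directed_pathD[OF assms(9)[unfolded D_def], folded D_def]
  \<comment> \<open>\<open>x\<close> and \<open>y\<close> are the items of the first and the last
    transfer of \<open>P\<close>; they coincide if \<open>P\<close> has only one.\<close>
  obtain x w2 P' where Px: "P = (w1, x, w2) # P'" using P(1,2) by (cases P) auto
  obtain y u P'' where Py: "P = P'' @ [(u, y, wt)]" "chain w1 P'' u"
    using P(1,2) by (cases P rule: rev_cases) (auto simp: chain_append)
  have ax: "x \<in> X" "f x = w1" "f' x = w2" "w1 \<noteq> w2" using P(5) Px arcD[of w1 x w2] by auto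
  have ay: "y \<in> X" "f y = u" "f' y = wt" "u \<noteq> wt" using P(5) Py arcD[of u y wt] by auto
  have inP1: "(w1, x, w2) \<in> set P" using Px by simp
  have inP2: "(u, y, wt) \<in> set P" using Py(1) by simp
  note inP = inP1 inP2
  have inD: "(w1, x, w2) \<in> arcs D" "(u, y, wt) \<in> arcs D" using inP P(5) by blast+
  have w1V: "w1 \<in> {1..k}" and uV: "u \<in> {1..k}" and wtV: "wt \<in> {1..k}"
    using V arc_ends(1)[OF inD(1)] arc_ends[OF inD(2)] by blast+
  \<comment> \<open>A label determines its arc, so edge-disjointness keeps both items off the
    cycles.\<close>
  have nx: "x \<notin> label ` set c" and ny: "y \<notin> label ` set c" if c: "c \<in> Y" for c
  proof -
    have "(f z, z, f' z) \<in> set c" if z: "z \<in> label ` set c" for z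
    proof -
      obtain i j where "(i, z, j) \<in> set c" using z by (auto simp: label_def)
      then show ?thesis using Yc(2)[OF c] arcD[of i z j] by auto
    qed
    moreover have "(f x, x, f' x) \<notin> set c" "(f y, y, f' y) \<notin> set c"
      using assms(10) c inP ax(2,3) ay(2,3) by auto
    ultimately show "x \<notin> label ` set c" "y \<notin> label ` set c" by blast+
  qed
  \<comment> \<open>\<open>x\<close> is sent to \<open>m\<close>: straight to \<open>wt\<close> if
    \<open>P\<close> is a single transfer, otherwise to the tail \<open>u\<close> of the last
    one.\<close>
  define m where "m = (if P' = [] then wt else u)"
  define Q where "Q = (if P' = [] then [(w1, x, wt)] else [(w1, x, u), (u, y, wt)])"
  have w1wt: "w1 \<noteq> wt" using P(4) Px by auto
  have u: "u \<noteq> w1" "x \<noteq> y" if "P' \<noteq> []"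
  proof -
    obtain e Q' where "P'' = e # Q'" using Px Py(1) \<open>P' \<noteq> []\<close> by (cases P'') auto
    then have "w1 \<in> fst ` set P''" using Px Py(1) by force
    then show "u \<noteq> w1" using P(3) Py(1) by auto
    then show "x \<noteq> y" using ax(2) ay(2) by auto
  qed
  have xy: "x = y" "u = w1" if "P' = []"
    using Px Py(1) that by (cases P''; simp)+
  \<comment> \<open>Both shapes of \<open>Q\<close> are treated alike from here on; in the short one
    the arcs \<open>(w1, x, m)\<close> and \<open>(u, y, wt)\<close> coincide.\<close>
  have Qcases: "x = y \<and> m = wt \<and> u = w1 \<or> x \<noteq> y \<and> m = u \<and> u \<noteq> w1"
    using u xy unfolding m_def by (cases "P' = []") simp_all
  have setQ: "set Q = {(w1, x, m), (u, y, wt)}"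
    using xy unfolding Q_def m_def by (cases "P' = []") simp_all
  have mw: "m \<noteq> w1" "m \<in> {1..k}"
    using u w1wt uV wtV unfolding m_def by auto
  \<comment> \<open>Only \<open>x\<close> may be sent to a wrong cluster, so its destination alone
    is overridden.\<close>
  define h where "h z = (if z = x then m else f' z)" for z
  let ?S = "\<Union>(set ` Y) \<union> set Q"
  have hy: "h y = wt" using Qcases ay(3) by (auto simp: h_def)
  have arcS: "z \<in> X \<and> f z = i \<and> h z = j \<and> i \<noteq> j" if z: "(i, z, j) \<in> ?S" for i z j
  proof -
    consider c where "c \<in> Y" "(i, z, j) \<in> set c" | "(i, z, j) = (w1, x, m)" | "(i, z, j) = (u, y, wt)"
      using z setQ by auto
    then show ?thesis
    proof cases
      case 1
      then have "(i, z, j) \<in> arcs D" using Yc(2) by blast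
      moreover have "z \<in> label ` set c" using 1(2) by (metis image_eqI label_arc)
      then have "z \<noteq> x" using nx[OF 1(1)] by blast
      ultimately show ?thesis using arcD[of i z j] by (simp add: h_def)
    next
      case 2
      then show ?thesis using ax mw(1) by (simp add: h_def)
    next
      case 3
      then show ?thesis using ay hy by simp
    qed
  qed
  have "covering f h (set ` Y) Q w1 wt"
  proof
    show "f z = i" if "(i, z, j) \<in> ?S" for i z j using arcS[OF that] by simp
    show "h z = j" if "(i, z, j) \<in> ?S" for i z j using arcS[OF that] by simp
    show "(i, z, i) \<notin> ?S" for i z using arcS[of i z i] by auto
    show "finite (set ` Y)" using assms(5) by simp
    show "circuit c" if "c \<in> set ` Y" for c using that Yc(1) by blast
    show "pairwise (\<lambda>c d. ends c \<inter> ends d = {}) (set ` Y)"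
    proof (rule pairwise_imageI)
      fix c d assume "c \<in> Y" "d \<in> Y" "c \<noteq> d"
      then show "ends (set c) \<inter> ends (set d) = {}"
        using assms(8) unfolding D_def vertices_on_CDG by (simp add: pairwise_def)
    qed
    show "chain w1 Q wt" "Q \<noteq> []" unfolding Q_def by simp_all
    show "distinct (map fst Q)" "wt \<notin> tails Q"
      using u w1wt ay(4) unfolding Q_def by auto
    show "c \<inter> set Q = {}" if "c \<in> set ` Y" for c
    proof -
      obtain d where d: "d \<in> Y" "c = set d" using \<open>c \<in> set ` Y\<close> by blast
      have "(w1, x, m) \<notin> set d" "(u, y, wt) \<notin> set d"
        using nx[OF d(1)] ny[OF d(1)] by (metis image_eqI label_arc)+
      then show ?thesis unfolding d(2) setQ by simp
    qed
  qed
  then interpret covering f h "set ` Y" Q w1 wt .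
  have "\<exists>M1 M2. staged ?S M1 M2"
  proof (rule realizable_all)
    show "set ` Y \<noteq> {}" using assms(6) by simp
    show "(\<exists>x. Q = [(w1, x, wt)]) \<or> (\<exists>u x y. Q = [(w1, x, u), (u, y, wt)])"
      unfolding Q_def by (cases "P' = []") simp_all
  qed
  then obtain M1 M2 where "staged ?S M1 M2" by blast
  then obtain g where M: "simple M1" "simple M2" "ends (set M1) \<subseteq> ends ?S"
    "ends (set M2) \<subseteq> ends ?S" "label ` set M1 \<subseteq> label ` ?S" "label ` set M2 \<subseteq> label ` ?S"
    "moves f (set M1) g" "moves g (set M2) (goal ?S)"
    unfolding staged_def by (elim conjE exE)
  define H where "H = goal ?S"
  define C'' where "C'' i = {z \<in> X. H z = i}" for i
  have "ends (set c) \<subseteq> {1..k}" if "c \<in> Y" for c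
    using Yc(2)[OF that] V unfolding ends_def by blast
  then have "ends (\<Union>(set ` Y)) \<subseteq> {1..k}" unfolding ends_def by blast
  moreover have "ends (set Q) \<subseteq> {1..k}"
    using w1V uV wtV mw(2) unfolding setQ by auto
  ultimately have S: "ends ?S \<subseteq> {1..k}" by simp
  have lab: "z \<in> label ` ?S \<longleftrightarrow> (f z, z, h z) \<in> ?S" for z
    by (rule label_image_iff) simp
  have SX: "label ` ?S \<subseteq> X"
    using lab arcS by (intro subsetI) blast
  have g: "located k X g (\<lambda>i. {z \<in> X. g z = i})"
    by (rule moves_located[OF f M(7)]) (use M(3) S in blast)
  have C''_def': "C'' = (\<lambda>i. {z \<in> X. H z = i})" by (rule ext) (simp add: C''_def)
  have H: "located k X H C''"
    unfolding C''_def' H_def by (rule moves_located[OF g M(8)]) (use M(4) S in blast)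
  have Hin: "H z = h z" if "z \<in> label ` ?S" for z using that by (simp add: H_def goal_def)
  have Hout: "H z = f z" if "z \<notin> label ` ?S" for z using that by (simp add: H_def goal_def)
  have xyS: "x \<in> label ` ?S" "y \<in> label ` ?S" unfolding setQ by (simp_all add: image_Un)
  have Hx: "H x = m" and Hy: "H y = wt" using Hin xyS hy by (simp_all add: h_def)
  have Hz: "H z = f' z \<or> H z = f z" if "z \<noteq> x" for z
    using that Hin[of z] Hout[of z] by (auto simp: h_def)
  have Hc: "z \<in> X \<and> f z = i \<and> f' z = j \<and> H z = j \<and> i \<noteq> j \<and> z \<noteq> x \<and> z \<noteq> y"
    if c: "c \<in> Y" "(i, z, j) \<in> set c" for c i z j
  proof -
    have zc: "z \<in> label ` set c" using c(2) by (metis image_eqI label_arc)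
    then have "z \<noteq> x" "z \<noteq> y" using nx ny c(1) by auto
    moreover have "(i, z, j) \<in> ?S" using c by auto
    then have "H z = h z" using Hin by (metis image_eqI label_arc)
    ultimately show ?thesis using Yc(2)[OF c(1)] c(2) arcD[of i z j] by (auto simp: h_def)
  qed
  \<comment> \<open>The net effect of both moves is one transfer per arc of \<open>?S\<close>, so
    changes of size can be read off from \<open>?S\<close>.\<close>
  have moved: "{z \<in> X. f z = v \<and> H z \<noteq> v} = {z. \<exists>j. (v, z, j) \<in> ?S}"
    "{z \<in> X. H z = v \<and> f z \<noteq> v} = {z. \<exists>i. (i, z, v) \<in> ?S}" for v
  proof -
    have 1: "(f z, z, H z) \<in> ?S" if z: "H z \<noteq> f z" for z
    proof -
      have l: "z \<in> label ` ?S" using z Hout by (rule contrapos_np)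
      then have "(f z, z, h z) \<in> ?S" by (simp only: lab)
      then show ?thesis unfolding Hin[OF l] .
    qed
    have 2: "z \<in> X \<and> f z = i \<and> H z = j \<and> i \<noteq> j" if ij: "(i, z, j) \<in> ?S" for i z j
      using arcS[OF ij] Hin[OF goal_arc(4)[OF subset_refl ij]] by simp
    have "(\<exists>j. (v, z, j) \<in> ?S) \<longleftrightarrow> z \<in> X \<and> f z = v \<and> H z \<noteq> v"
      "(\<exists>i. (i, z, v) \<in> ?S) \<longleftrightarrow> z \<in> X \<and> H z = v \<and> f z \<noteq> v" if "z \<in> X" for z
      using 1[of z] 2[of _ z v] 2[of v z] that by metis+
    moreover have "z \<in> X" if "(i, z, j) \<in> ?S" for i z j using 2[OF that] by simp
    ultimately show "{z \<in> X. f z = v \<and> H z \<noteq> v} = {z. \<exists>j. (v, z, j) \<in> ?S}"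
      "{z \<in> X. H z = v \<and> f z \<noteq> v} = {z. \<exists>i. (i, z, v) \<in> ?S}"
      by (smt (verit) Collect_cong)+
  qed
  let ?O = "\<lambda>v. {z. \<exists>j. (v, z, j) \<in> \<Union>(set ` Y)}" and ?I = "\<lambda>v. {z. \<exists>i. (i, z, v) \<in> \<Union>(set ` Y)}"
  have sizes: "card (C'' v) + card {z. \<exists>j. (v, z, j) \<in> ?S} = card (C v) + card {z. \<exists>i. (i, z, v) \<in> ?S}"
    if "v \<in> {1..k}" for v
    using card_after_moves[OF assms(2), of H v f] moved[of v] f that
    unfolding C''_def located_def by simp
  have notY: "x \<notin> ?O v" "y \<notin> ?I v" for v using Hc by blast+
  have "double_move k X C C''"
    unfolding double_move_def
    using simple_move[OF f g M(7,1)] simple_move[OF g H M(8)[folded H_def] M(2)] M(5,6) SX by blast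
  moreover have "label e \<in> C'' (head D e)" if c: "c \<in> Y" "e \<in> set c" for c e
  proof -
    obtain i z j where e: "e = (i, z, j)" by (cases e) auto
    then have "(i, z, j) \<in> ?S" using c by auto
    then show ?thesis
      using goal_arc(3)[OF subset_refl, of i z j] arcS[of i z j] unfolding e D_def C''_def H_def by simp
  qed
  \<comment> \<open>Apart from the balanced cycles, \<open>w1\<close> loses \<open>x\<close>, and no
    arc of \<open>Q\<close> enters it.\<close>
  moreover have "{z. \<exists>j. (w1, z, j) \<in> ?S} = insert x (?O w1)" "{z. \<exists>i. (i, z, w1) \<in> ?S} = ?I w1"
    using Qcases mw(1) w1wt unfolding setQ by auto
  then have "card (C'' w1) < card (C w1)"
    using sizes[OF w1V] arcs_at_balanced[of w1] notY(1)[of w1] by simp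
  moreover have "{z. \<exists>j. (wt, z, j) \<in> ?S} = ?O wt" "{z. \<exists>i. (i, z, wt) \<in> ?S} = insert y (?I wt)"
    using Qcases w1wt ay(4) unfolding setQ by auto
  then have "card (C'' wt) > card (C wt)"
    using sizes[OF wtV] arcs_at_balanced[of wt] notY(2)[of wt] by simp
  moreover have "x \<in> correct_sent C C' C'' w1"
    using w1V f f' ax Hx mw(1) by (auto simp: correct_sent_def located_def C''_def)
  moreover have "y \<in> correct_received C C' C'' wt"
    using wtV f f' ay Hy by (auto simp: correct_received_def located_def C''_def)
  moreover have "shared_degree (CDG k C'' C') v + 1 \<le> shared_degree D v"
    if c: "c \<in> Y" "v \<in> vertices_on D c" for c v
  proof -
    have v: "v \<in> ends (set c)" using c(2) unfolding D_def vertices_on_CDG .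
    obtain zo j where zo: "(v, zo, j) \<in> set c" using circuit_arcs_at(1)[OF Yc(1)[OF c(1)] v] by blast
    obtain zi i where zi: "(i, zi, v) \<in> set c" using circuit_arcs_at(2)[OF Yc(1)[OF c(1)] v] by blast
    note zo' = Hc[OF c(1) zo] and zi' = Hc[OF c(1) zi]
    let ?in = "{z \<in> X. f' z = v \<and> f z \<noteq> v}" and ?out = "{z \<in> X. f z = v \<and> f' z \<noteq> v}"
    let ?in' = "{z \<in> X. f' z = v \<and> H z \<noteq> v}" and ?out' = "{z \<in> X. H z = v \<and> f' z \<noteq> v}"
    have fin: "finite ?in" "finite ?out" using assms(2) by simp_all
    \<comment> \<open>Only items outside their targets are moved, so an item still missing from
      \<open>v\<close> was missing at the start; \<open>zi\<close> has arrived.\<close>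
    have "z \<in> ?in - {zi}" if z: "z \<in> ?in'" for z
      using z zi' Hz[of z] ax by (cases "z = x") auto
    then have "card ?in' \<le> card (?in - {zi})" using fin(1) by (intro card_mono) auto
    also have "\<dots> + 1 \<le> card ?in" using card_Suc_Diff1[OF fin(1), of zi] zi' by auto
    finally have in_le: "card ?in' + 1 \<le> card ?in" by simp
    have o: "z \<in> ?out - {zo, y}" if z: "z \<in> ?out'" "z \<noteq> x" for z
      using z zo' Hz[of z] Hy ay(3) by auto
    \<comment> \<open>The only possible new wrong item at \<open>v\<close> is \<open>x\<close>, and
      only if \<open>v = u\<close> and \<open>x\<close> differs from \<open>y\<close>. In that case
      \<open>u\<close> has sent \<open>y\<close> besides the cycle item \<open>zo\<close>, so two
      wrong items left for one that came.\<close>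
    have out_le: "card ?out' + 1 \<le> card ?out"
    proof (cases "x \<in> ?out'")
      case True
      then have "y \<in> ?out" "zo \<in> ?out" "zo \<noteq> y" using Qcases Hx ay zo' by auto
      then have s: "{zo, y} \<subseteq> ?out" "card {zo, y} = 2" by simp_all
      then have "card (?out - {zo, y}) = card ?out - 2" "2 \<le> card ?out"
        using card_Diff_subset[of "{zo, y}" ?out] card_mono[OF fin(2) s(1)] by simp_all
      moreover have "card ?out' \<le> card (insert x (?out - {zo, y}))"
        using o fin(2) by (intro card_mono) auto
      then have "card ?out' \<le> Suc (card (?out - {zo, y}))"
        using card_insert_if[of "?out - {zo, y}" x] fin(2) by (auto split: if_splits)
      ultimately show ?thesis by simp
    next
      case False
      then have "?out' \<subseteq> ?out - {zo}" using o by blast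
      then have "card ?out' \<le> card (?out - {zo})" using fin(2) by (intro card_mono) auto
      moreover have "Suc (card (?out - {zo})) = card ?out"
        using card_Suc_Diff1[OF fin(2), of zo] zo' by simp
      ultimately show ?thesis by simp
    qed
    show ?thesis
      using in_le out_le
      unfolding D_def shared_degree_def in_degree_CDG[OF f f'] out_degree_CDG[OF f f']
        in_degree_CDG[OF H f'] out_degree_CDG[OF H f'] by linarith
  qed
  ultimately show ?thesis
    using nx ny by (intro exI[of _ C''] conjI bexI[of _ x] bexI[of _ y]) blast+
qed

end
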